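(* Let $T$ be a finite tree, let $(U_t)_{t\in V(T)}$ be pairwise disjoint finite sets, and, for each edge $e=tu$ of $T$, let $H_e$ be a bipartite graph with classes $U_t$ and $U_u$. Regard $E(H_e)$ as the color class $e$. Let $q:E(T)\to\mathbb Z_{>0}$, with $q_e:=q(e)$. There is a matching $M\subseteq\bigcup_{e\in E(T)}E(H_e)$ such that $$|M\cap E(H_e)|=q_e\qquad\text{for every color }e\in E(T)$$ if and only if $$\nu\Bigl(\bigcup_{e\in F}E(H_e)\Bigr)\ge\sum_{e\in F}q_e\qquad\text{for every }F\subseteq E(T).$$ Moreover, the existence of such a matching can be tested in polynomial time.
   Context: For a set of edges, $\nu$ denotes the maximum size of a matching (a set of pairwise vertex-disjoint edges) contained in it; here all edges are between elements of $\bigcup_{t\in V(T)}U_t$. The input of the algorithmic problem is $T$, the sets $U_t$, the graphs $H_e$ (given by explicit edge lists) and $q$; polynomial time is with respect to the size of this input. *)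

theory Defs
  imports "HOL-Library.Disjoint_Sets" "HOL-Computational_Algebra.Polynomial"
begin

section \<open>Finite trees\<close>

text \<open>
  A simple graph is given by its vertex set \<open>V\<close> and its set \<open>E\<close> of edges, an edge being a set of two
  vertices. (The predicate \<open>tree\<close> of the AFP entry Graph Theory is about digraphs and only excludes
  directed cycles, so that it accepts a transitively oriented triangle.)
\<close>

definition finite_simple_graph :: "'t set \<Rightarrow> 't set set \<Rightarrow> bool" where
  "finite_simple_graph V E \<longleftrightarrow>
     finite V \<and> (\<forall>e\<in>E. \<exists>t u. t \<in> V \<and> u \<in> V \<and> t \<noteq> u \<and> e = {t, u})"

definition connected_graph :: "'t set \<Rightarrow> 't set set \<Rightarrow> bool" where
  "connected_graph V E \<longleftrightarrow> V \<noteq> {} \<and> (\<forall>t\<in>V. \<forall>u\<in>V. (\<lambda>x y. {x, y} \<in> E)\<^sup>*\<^sup>* t u)"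

definition is_cycle :: "'t set set \<Rightarrow> 't list \<Rightarrow> bool" where
  "is_cycle E c \<longleftrightarrow> length c \<ge> 3 \<and> distinct c \<and>
     (\<forall>i<length c. {c ! i, c ! (Suc i mod length c)} \<in> E)"

definition finite_tree :: "'t set \<Rightarrow> 't set set \<Rightarrow> bool" where
  "finite_tree V E \<longleftrightarrow>
     finite_simple_graph V E \<and> connected_graph V E \<and> (\<nexists>c. is_cycle E c)"


section \<open>Matchings\<close>

definition matching :: "'v set set \<Rightarrow> bool" where
  "matching M \<longleftrightarrow> disjoint M"

text \<open>Only meaningful for a finite set of edges.\<close>

definition matching_number :: "'v set set \<Rightarrow> nat" ("\<nu>") where
  "\<nu> S = Max (card ` {M. M \<subseteq> S \<and> matching M})"


section \<open>Colour classes indexed by the edges of a tree\<close>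

text \<open>
  \<open>H e\<close> is the edge set of the bipartite graph belonging to the tree edge \<open>e\<close>. The values of \<open>U\<close>
  outside \<open>V\<close> and those of \<open>H\<close> and \<open>q\<close> outside \<open>E\<close> play no role.
\<close>

locale tree_colour_classes =
  fixes V :: "'t set" and E :: "'t set set"
    and U :: "'t \<Rightarrow> 'v set" and H :: "'t set \<Rightarrow> 'v set set" and q :: "'t set \<Rightarrow> nat"
  assumes tree: "finite_tree V E"
    and finite_U: "\<And>t. t \<in> V \<Longrightarrow> finite (U t)"
    and disjoint_U: "disjoint_family_on U V"
    and bipartite_H: "\<And>t u h. {t, u} \<in> E \<Longrightarrow> h \<in> H {t, u} \<Longrightarrow> \<exists>x\<in>U t. \<exists>y\<in>U u. h = {x, y}"
    and q_pos: "\<And>e. e \<in> E \<Longrightarrow> q e > 0"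

definition exact_matching ::
    "'t set set \<Rightarrow> ('t set \<Rightarrow> 'v set set) \<Rightarrow> ('t set \<Rightarrow> nat) \<Rightarrow> 'v set set \<Rightarrow> bool" where
  "exact_matching E H q M \<longleftrightarrow>
     matching M \<and> M \<subseteq> (\<Union>e\<in>E. H e) \<and> (\<forall>e\<in>E. card (M \<inter> H e) = q e)"


section \<open>Polynomial time\<close>

text \<open>
  The machine model is the WHILE language of N. D. Jones (Computability and Complexity from a
  Programming Perspective, 1997): a program has finitely many variables, which hold binary trees
  without labels. The evaluation of an expression is charged the number of nodes (leaves included)
  of the value of every subexpression, not one unit per operation. A Turing machine that keeps
  the variables as words on its tapes thus runs a program with polynomial overhead in the cost, and
  conversely a program simulates a Turing machine, whose tape halves are trees, with polynomial
  overhead; hence polynomial time has its usual meaning.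
\<close>

datatype data = Leaf | Node data data

datatype expr = Var nat | Nil_Expr | Cons_Expr expr expr | Hd expr | Tl expr | Eq expr expr

datatype com = Skip | Assign nat expr | Seq com com | If expr com com | While expr com

type_synonym state = "nat \<Rightarrow> data"

text \<open>The tree \<open>Leaf\<close> stands for falsity, every other tree for truth.\<close>

primrec left :: "data \<Rightarrow> data" where
  "left Leaf = Leaf"
| "left (Node a b) = a"

primrec right :: "data \<Rightarrow> data" where
  "right Leaf = Leaf"
| "right (Node a b) = b"

definition enc_bool :: "bool \<Rightarrow> data" where
  "enc_bool b = (if b then Node Leaf Leaf else Leaf)"

primrec eval :: "expr \<Rightarrow> state \<Rightarrow> data" where
  "eval (Var x) s = s x"
| "eval Nil_Expr s = Leaf"
| "eval (Cons_Expr a b) s = Node (eval a s) (eval b s)"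
| "eval (Hd a) s = left (eval a s)"
| "eval (Tl a) s = right (eval a s)"
| "eval (Eq a b) s = enc_bool (eval a s = eval b s)"

primrec nodes :: "data \<Rightarrow> nat" where
  "nodes Leaf = 1"
| "nodes (Node a b) = Suc (nodes a + nodes b)"

primrec cost :: "expr \<Rightarrow> state \<Rightarrow> nat" where
  "cost (Var x) s = nodes (eval (Var x) s)"
| "cost Nil_Expr s = nodes (eval Nil_Expr s)"
| "cost (Cons_Expr a b) s = cost a s + cost b s + nodes (eval (Cons_Expr a b) s)"
| "cost (Hd a) s = cost a s + nodes (eval (Hd a) s)"
| "cost (Tl a) s = cost a s + nodes (eval (Tl a) s)"
| "cost (Eq a b) s = cost a s + cost b s + nodes (eval (Eq a b) s)"

text \<open>\<open>exec c s n s'\<close>: the program \<open>c\<close>, started in \<open>s\<close>, halts in \<open>s'\<close> after time \<open>n\<close>.\<close>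

inductive exec :: "com \<Rightarrow> state \<Rightarrow> nat \<Rightarrow> state \<Rightarrow> bool" where
  Skip: "exec Skip s 1 s"
| Assign: "exec (Assign x a) s (Suc (cost a s)) (s(x := eval a s))"
| Seq: "exec c s m s' \<Longrightarrow> exec d s' n s'' \<Longrightarrow> exec (Seq c d) s (Suc (m + n)) s''"
| If_True: "eval a s \<noteq> Leaf \<Longrightarrow> exec c s n s' \<Longrightarrow> exec (If a c d) s (Suc (cost a s + n)) s'"
| If_False: "eval a s = Leaf \<Longrightarrow> exec d s n s' \<Longrightarrow> exec (If a c d) s (Suc (cost a s + n)) s'"
| While_False: "eval a s = Leaf \<Longrightarrow> exec (While a c) s (Suc (cost a s)) s"
| While_True: "eval a s \<noteq> Leaf \<Longrightarrow> exec c s m s' \<Longrightarrow> exec (While a c) s' n s'' \<Longrightarrow>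
    exec (While a c) s (Suc (cost a s + m + n)) s''"

inductive_cases exec_elims:
  "exec Skip s n s'" "exec (Assign x a) s n s'" "exec (Seq c d) s n s'"
  "exec (If a c d) s n s'" "exec (While a c) s n s'"

lemma exec_deterministic:
  assumes "exec c s n s'" and "exec c s m t'"
  shows "m = n \<and> t' = s'"
  using assms
proof (induction arbitrary: m t' rule: exec.induct)
  case (Skip s)
  then show ?case by (rule exec_elims) simp
next
  case (Assign x a s)
  then show ?case by (rule exec_elims) simp
next
  case (Seq c s k s' d n s'')
  from Seq.prems show ?case
    by (rule exec_elims) (metis Seq.IH)
next
  case (If_True a s c n s' d)
  from If_True.prems show ?case
    by (rule exec_elims) (metis If_True.IH If_True.hyps(1))+
next
  case (If_False a s d n s' c)
  from If_False.prems show ?case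
    by (rule exec_elims) (metis If_False.IH If_False.hyps(1))+
next
  case (While_False a s c)
  from While_False.prems show ?case
    by (rule exec_elims) (metis While_False.hyps)+
next
  case (While_True a s c k s' n s'')
  from While_True.prems show ?case
    by (rule exec_elims) (metis While_True.IH While_True.hyps(1))+
qed

text \<open>
  A problem is a set of pairs of an input and its correct answer; other inputs (in our case, those
  that do not encode an instance) carry no requirement. The input is the initial value of
  variable 0, the answer is read off its final value.
\<close>

definition decidable_in_poly_time :: "(data \<times> bool) set \<Rightarrow> bool" where
  "decidable_in_poly_time P \<longleftrightarrow>
     (\<exists>c (p :: nat poly). \<forall>(d, answer)\<in>P. \<exists>n s.
        exec c ((\<lambda>_. Leaf)(0 := d)) n s \<and> n \<le> poly p (nodes d) \<and> (s 0 \<noteq> Leaf \<longleftrightarrow> answer))"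


section \<open>Encoding of the input\<close>

text \<open>
  The vertices of the tree and the elements of the sets \<open>U t\<close> are named by natural numbers. The first
  component of an input lists the vertices \<open>t\<close>, each with a list of \<open>U t\<close>; the second one lists the
  tree edges \<open>{t, u}\<close>, each with a list of the edges \<open>{x, y}\<close> of its graph and with its number \<open>q\<close>.
  Edges are written as ordered pairs; the order of the two ends and that of the lists are
  arbitrary.
\<close>

type_synonym input =
  "(nat \<times> nat list) list \<times> ((nat \<times> nat) \<times> (nat \<times> nat) list \<times> nat) list"

definition unordered :: "'a \<times> 'a \<Rightarrow> 'a set" where
  "unordered p = {fst p, snd p}"

definition lists_edges :: "('a \<times> 'a) list \<Rightarrow> 'a set set \<Rightarrow> bool" where
  "lists_edges ps S \<longleftrightarrow> distinct (map unordered ps) \<and> set (map unordered ps) = S"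

definition describes :: "input \<Rightarrow> nat set \<Rightarrow> nat set set \<Rightarrow> (nat \<Rightarrow> nat set) \<Rightarrow>
    (nat set \<Rightarrow> nat set set) \<Rightarrow> (nat set \<Rightarrow> nat) \<Rightarrow> bool" where
  "describes I V E U H q \<longleftrightarrow> (case I of (vs, es) \<Rightarrow>
     distinct (map fst vs) \<and> set (map fst vs) = V \<and>
     (\<forall>(t, xs)\<in>set vs. distinct xs \<and> set xs = U t) \<and>
     lists_edges (map fst es) E \<and>
     (\<forall>(p, hs, k)\<in>set es. lists_edges hs (H (unordered p)) \<and> k = q (unordered p)))"

lemma ex_lists_edges:
  assumes "finite S" and "\<And>e. e \<in> S \<Longrightarrow> \<exists>x y. e = {x, y}"
  shows "\<exists>ps. lists_edges ps S"
proof -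
  from \<open>finite S\<close> obtain es where es: "set es = S" "distinct es"
    using finite_distinct_list by blast
  from assms(2) have "\<forall>e\<in>S. \<exists>p. unordered p = e"
    by (force simp: unordered_def)
  then obtain f where "\<forall>e\<in>S. unordered (f e) = e"
    by metis
  with es have "map unordered (map f es) = es"
    by (auto intro: map_idI)
  with es show ?thesis
    unfolding lists_edges_def by metis
qed

lemma ex_describes:
  assumes "tree_colour_classes V E U H q"
  shows "\<exists>I. describes I V E U H q"
proof -
  interpret tree_colour_classes V E U H q by fact
  have E: "\<exists>t u. t \<in> V \<and> u \<in> V \<and> e = {t, u}" if "e \<in> E" for e
    using tree that unfolding finite_tree_def finite_simple_graph_def by blast
  have fV: "finite V"
    using tree unfolding finite_tree_def finite_simple_graph_def by blast
  have "finite E"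
    by (rule finite_subset[of _ "Pow V"]) (use E fV in auto)
  then obtain ps where ps: "lists_edges ps E"
    using ex_lists_edges[of E] E by blast
  have "\<exists>hs. lists_edges hs (H e)" if "e \<in> E" for e
  proof -
    from E[OF that] obtain t u where e: "t \<in> V" "u \<in> V" "e = {t, u}" by blast
    have H: "\<exists>x\<in>U t. \<exists>y\<in>U u. h = {x, y}" if "h \<in> H e" for h
      using bipartite_H that \<open>e \<in> E\<close> e by blast
    have "finite (H e)"
      by (rule finite_subset[of _ "Pow (U t \<union> U u)"]) (use H finite_U e in auto)
    then show ?thesis
      using ex_lists_edges[of "H e"] H by blast
  qed
  then obtain L where L: "\<And>e. e \<in> E \<Longrightarrow> lists_edges (L e) (H e)" by metis
  have "\<forall>t\<in>V. \<exists>xs. distinct xs \<and> set xs = U t"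
    using finite_U finite_distinct_list by metis
  then obtain K where K: "\<And>t. t \<in> V \<Longrightarrow> distinct (K t) \<and> set (K t) = U t" by metis
  obtain ts where ts: "distinct ts" "set ts = V"
    using finite_distinct_list[OF fV] by blast
  have "unordered p \<in> E" if "p \<in> set ps" for p
    using ps that unfolding lists_edges_def by auto
  with L K ts ps have "describes (map (\<lambda>t. (t, K t)) ts,
      map (\<lambda>p. (p, L (unordered p), q (unordered p))) ps) V E U H q"
    by (auto simp: describes_def o_def image_image)
  then show ?thesis ..
qed

text \<open>Numbers are written in binary, the least significant digit first.\<close>

fun enc_nat :: "nat \<Rightarrow> data" where
  "enc_nat n = (if n = 0 then Leaf else Node (enc_bool (odd n)) (enc_nat (n div 2)))"

declare enc_nat.simps [simp del]

definition enc_list :: "('a \<Rightarrow> data) \<Rightarrow> 'a list \<Rightarrow> data" where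
  "enc_list f xs = foldr (\<lambda>x d. Node (f x) d) xs Leaf"

definition enc_pair :: "('a \<Rightarrow> data) \<Rightarrow> ('b \<Rightarrow> data) \<Rightarrow> 'a \<times> 'b \<Rightarrow> data" where
  "enc_pair f g p = Node (f (fst p)) (g (snd p))"

definition enc_input :: "input \<Rightarrow> data" where
  "enc_input =
     enc_pair
       (enc_list (enc_pair enc_nat (enc_list enc_nat)))
       (enc_list (enc_pair (enc_pair enc_nat enc_nat)
         (enc_pair (enc_list (enc_pair enc_nat enc_nat)) enc_nat)))"

end

theory Submission
  imports Defs
begin

text \<open>
  Let \<open>d\<^sub>t\<close> be the sum of \<open>q e\<close> over the tree edges \<open>e\<close> at \<open>t\<close>. An exact matching covers exactly \<open>d\<^sub>t\<close>
  vertices of each class \<open>U t\<close>. Conversely, a matching with this property is exact: the numbers of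
  edges of the single colours are determined by their sums at the vertices of \<open>T\<close>, since at a leaf
  there is only one summand (\<open>forest_degrees_determine_weights\<close>). This step relies on the absence of cycles in \<open>T\<close>.
  So the problem is one of ordinary bipartite matching: give each class \<open>U t\<close> as many as
  \<open>card (U t) - d\<^sub>t\<close> dummies, joined to all of \<open>U t\<close>, that absorb the vertices to be left uncovered; an
  exact matching exists if and only if all vertices and dummies can be matched
  (\<open>exact_matching_iff_saturates\<close>).

  The numbers \<open>\<nu>\<close> come in by Hall's theorem (\<open>hall_side\<close>). For a set \<open>S\<close> of vertices and
  dummies on one side of the bipartition, consider the colours that join a class meeting \<open>S\<close> to a
  class none of whose dummies lies in \<open>S\<close>. Their edges are covered by the neighbours of \<open>S\<close> and the
  vertices outside \<open>S\<close>, so that \<open>\<nu>\<close> bounds the number of neighbours from below; counting vertices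
  and dummies turns this bound into Hall's condition.

  Both Hall's theorem and the algorithm rest on an auction. A vertex without a partner bids for a
  cheapest possible partner, which raises the price of that partner by one and takes it from its
  previous owner. Under Hall's condition no price exceeds the number \<open>n\<close> of items
  (\<open>auction_price_bound\<close>), so that there are at most \<open>n\<^sup>2\<close> bids, and when nobody can bid, all are
  matched. For the program it suffices to make more bids than that and to check whether all are
  matched. The list of bids is its whole state: owners and prices are computed from it. Each step
  adds a single bid, one of the arcs of the input, which makes the sizes easy to bound.

  The time bound is obtained from closure properties of a class \<open>polytime\<close> of functions on binary
  trees: it contains the basic operations and is closed under composition, case distinction and
  iteration over a list whose step enlarges the accumulator by a bounded amount
  (\<open>polytime_fold\<close>). Every function of the decision procedure is composed from these.
\<close>

section \<open>Forests\<close>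

definition forest :: "'t set set \<Rightarrow> bool" where
  "forest E \<longleftrightarrow> finite E \<and> (\<forall>e\<in>E. \<exists>t u. t \<noteq> u \<and> e = {t, u}) \<and> (\<nexists>c. is_cycle E c)"

definition is_path :: "'t set set \<Rightarrow> 't list \<Rightarrow> bool" where
  "is_path E p \<longleftrightarrow> distinct p \<and> (\<forall>i. Suc i < length p \<longrightarrow> {p ! i, p ! Suc i} \<in> E)"

lemma is_path_Cons:
  assumes "is_path E (t # p)" and "w \<notin> set (t # p)" and "{w, t} \<in> E"
  shows "is_path E (w # t # p)"
  using assms unfolding is_path_def by (auto simp: nth_Cons split: nat.split)

text \<open>Other neighbours of the first vertex of a longest path would extend it or close a cycle.\<close>

lemma forest_has_leaf:
  assumes "forest E" and "E \<noteq> {}"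
  shows "\<exists>t u. t \<noteq> u \<and> {t, u} \<in> E \<and> (\<forall>e\<in>E. t \<in> e \<longrightarrow> e = {t, u})"
proof -
  from assms obtain a b where ab: "a \<noteq> b" "{a, b} \<in> E"
    unfolding forest_def by (metis ex_in_conv)
  let ?Q = "\<lambda>p. is_path E p \<and> 2 \<le> length p"
  have "finite (\<Union>E)"
    using assms(1) unfolding forest_def by (metis finite.emptyI finite.insertI finite_Union)
  have "length p < Suc (card (\<Union>E))" if "?Q p" for p
  proof -
    have "p ! i \<in> \<Union>E" if "i < length p" for i
    proof (cases i)
      case 0
      with \<open>?Q p\<close> have "{p ! i, p ! Suc i} \<in> E" unfolding is_path_def by simp
      then show ?thesis by blast
    next
      case (Suc j)
      with \<open>?Q p\<close> that have "{p ! j, p ! i} \<in> E" unfolding is_path_def by simp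
      then show ?thesis by blast
    qed
    then have "set p \<subseteq> \<Union>E" by (metis in_set_conv_nth subsetI)
    with \<open>?Q p\<close> \<open>finite (\<Union>E)\<close> show ?thesis
      unfolding is_path_def by (metis card_mono distinct_card le_imp_less_Suc)
  qed
  moreover have "?Q [a, b]" using ab by (auto simp: is_path_def)
  ultimately obtain p where p: "?Q p" and max: "\<And>p'. ?Q p' \<Longrightarrow> length p' \<le> length p"
    using ex_has_greatest_nat[of ?Q "[a, b]" length] by (metis less_imp_le)
  then obtain t u r where p_eq: "p = t # u # r"
    by (metis (no_types, lifting) Suc_le_length_iff numeral_2_eq_2)
  have tu: "t \<noteq> u" "{t, u} \<in> E"
    using p unfolding p_eq is_path_def by (auto dest: spec[of _ 0])
  have "e = {t, u}" if e: "e \<in> E" "t \<in> e" for e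
  proof (rule ccontr)
    assume ne: "e \<noteq> {t, u}"
    from assms(1) e obtain w where w: "e = {t, w}" "w \<noteq> t"
      unfolding forest_def by (metis insertE insert_commute singletonD)
    have "w \<in> set p"
    proof (rule ccontr)
      assume "w \<notin> set p"
      then have "?Q (w # p)"
        using is_path_Cons[of E t "u # r" w] p e w by (auto simp: p_eq insert_commute)
      from max[OF this] show False by simp
    qed
    with w ne obtain j where j: "j < length p" "p ! j = w" "2 \<le> j"
      unfolding in_set_conv_nth p_eq
      by (metis One_nat_def Suc_leI less_2_cases not_less nth_Cons_0 nth_Cons_Suc)
    define c where "c = take (Suc j) p"
    have len: "length c = Suc j" using j by (simp add: c_def)
    have "{c ! i, c ! (Suc i mod length c)} \<in> E" if "i < length c" for i
    proof (cases "i = j")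
      case True
      have "c ! 0 = t" by (simp add: c_def p_eq)
      with True j len e w show ?thesis by (simp add: c_def insert_commute)
    next
      case False
      with that len j have "Suc i < length p" "c ! i = p ! i" "c ! Suc i = p ! Suc i" "i < j"
        by (auto simp: c_def)
      with len p show ?thesis by (simp add: is_path_def)
    qed
    moreover have "distinct c" using p by (simp add: c_def is_path_def)
    ultimately have "is_cycle E c" unfolding is_cycle_def using len j by simp
    with assms(1) show False unfolding forest_def by blast
  qed
  with tu show ?thesis by blast
qed

lemma forest_subset: "forest E \<Longrightarrow> E' \<subseteq> E \<Longrightarrow> forest E'"
  unfolding forest_def is_cycle_def by (meson finite_subset subset_iff)

lemma forest_induct [consumes 1, case_names empty leaf]:
  assumes "forest E" and "P {}"
    and leaf: "\<And>E t u. finite E \<Longrightarrow> {t, u} \<notin> E \<Longrightarrow> t \<noteq> u \<Longrightarrow> \<forall>e\<in>E. t \<notin> e \<Longrightarrow> P E \<Longrightarrow>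
      P (insert {t, u} E)"
  shows "P E"
proof -
  have "finite E" using assms(1) by (simp add: forest_def)
  then show ?thesis using assms(1)
  proof (induction E rule: finite_psubset_induct)
    case (psubset E)
    show ?case
    proof (cases "E = {}")
      case True
      with assms(2) show ?thesis by simp
    next
      case False
      with forest_has_leaf psubset.prems obtain t u
        where tu: "t \<noteq> u" "{t, u} \<in> E" "\<forall>e\<in>E. t \<in> e \<longrightarrow> e = {t, u}" by metis
      let ?E = "E - {{t, u}}"
      have "P ?E"
        using psubset.IH[of ?E] psubset.prems forest_subset[of E ?E] tu(2) by blast
      then have "P (insert {t, u} ?E)"
        using leaf[of ?E t u] psubset.hyps tu by blast
      with tu(2) show ?thesis by (simp add: insert_absorb)
    qed
  qed
qed

lemma forest_bipartition:
  assumes "forest E"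
  shows "\<exists>side :: 't \<Rightarrow> bool. \<forall>t u. {t, u} \<in> E \<longrightarrow> side t \<noteq> side u"
  using assms
proof (induction rule: forest_induct)
  case (leaf E t u)
  then obtain side :: "'t \<Rightarrow> bool" where side: "\<And>a b. {a, b} \<in> E \<Longrightarrow> side a \<noteq> side b" by blast
  have "(side(t := \<not> side u)) a \<noteq> (side(t := \<not> side u)) b" if "{a, b} \<in> insert {t, u} E" for a b
  proof (cases "{a, b} = {t, u}")
    case True
    with leaf.hyps show ?thesis by (auto simp: doubleton_eq_iff)
  next
    case False
    with that leaf.hyps have "{a, b} \<in> E" "a \<noteq> t" "b \<noteq> t" by auto
    with side show ?thesis by simp
  qed
  then show ?case by blast
qed simp

text \<open>The incidence matrix of a forest has linearly independent columns: at a leaf, the degree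
  determines the weight of the only edge there.\<close>

lemma forest_degrees_determine_weights:
  fixes m q :: "'t set \<Rightarrow> nat"
  assumes "forest E" and "\<And>t. (\<Sum>e\<in>{e \<in> E. t \<in> e}. m e) = (\<Sum>e\<in>{e \<in> E. t \<in> e}. q e)"
    and "e \<in> E"
  shows "m e = q e"
  using assms
proof (induction arbitrary: e rule: forest_induct)
  case (leaf E t u)
  have split: "(\<Sum>e\<in>{e \<in> insert {t, u} E. v \<in> e}. w e) =
      (if v \<in> {t, u} then w {t, u} else 0) + (\<Sum>e\<in>{e \<in> E. v \<in> e}. w e)"
    for v and w :: "'t set \<Rightarrow> nat"
  proof (cases "v \<in> {t, u}")
    case True
    then have "{e \<in> insert {t, u} E. v \<in> e} = insert {t, u} {e \<in> E. v \<in> e}" by blast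
    with True leaf.hyps show ?thesis by (simp add: sum.insert)
  next
    case False
    then have "{e \<in> insert {t, u} E. v \<in> e} = {e \<in> E. v \<in> e}" by blast
    with False show ?thesis by auto
  qed
  have none: "{e \<in> E. t \<in> e} = {}" using leaf.hyps by blast
  have tu: "m {t, u} = q {t, u}"
    using leaf.prems(1)[of t] unfolding split none by simp
  have "(\<Sum>e\<in>{e \<in> E. v \<in> e}. m e) = (\<Sum>e\<in>{e \<in> E. v \<in> e}. q e)" for v
    using leaf.prems(1)[of v] tu unfolding split by (auto split: if_splits)
  with leaf.IH leaf.prems(2) tu show ?case by blast
qed simp


section \<open>Saturating assignments and auctions\<close>

text \<open>Throughout, the second component of an arc is the one to be assigned (the bidder), the first one is
  what it is assigned to (the item).\<close>

definition saturates :: "('b \<times> 'a) set \<Rightarrow> 'a set \<Rightarrow> bool" where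
  "saturates A X \<longleftrightarrow> (\<exists>\<sigma>. inj_on \<sigma> X \<and> (\<forall>x\<in>X. (\<sigma> x, x) \<in> A))"

definition hall :: "('b \<times> 'a) set \<Rightarrow> 'a set \<Rightarrow> bool" where
  "hall A X \<longleftrightarrow> (\<forall>S\<subseteq>X. card S \<le> card (A\<inverse> `` S))"

lemma saturates_subset: "saturates A X \<Longrightarrow> X' \<subseteq> X \<Longrightarrow> saturates A X'"
  unfolding saturates_def by (meson inj_on_subset subset_iff)

lemma saturates_imp_hall:
  assumes "saturates A X" and "finite A"
  shows "hall A X"
  unfolding hall_def
proof (intro allI impI)
  fix S assume "S \<subseteq> X"
  from assms(1) obtain \<sigma> where \<sigma>: "inj_on \<sigma> X" "\<forall>x\<in>X. (\<sigma> x, x) \<in> A"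
    unfolding saturates_def by blast
  have "card S = card (\<sigma> ` S)"
    using \<sigma>(1) \<open>S \<subseteq> X\<close> by (simp add: card_image inj_on_subset)
  also have "\<dots> \<le> card (A\<inverse> `` S)"
    using \<sigma>(2) \<open>S \<subseteq> X\<close> assms(2) by (intro card_mono) (auto simp: finite_Image)
  finally show "card S \<le> card (A\<inverse> `` S)" .
qed

lemma saturates_image:
  assumes "inj f"
  shows "saturates (map_prod f f ` A) (f ` X) \<longleftrightarrow> saturates A X"
proof
  assume "saturates A X"
  then obtain \<sigma> where \<sigma>: "inj_on \<sigma> X" "\<forall>x\<in>X. (\<sigma> x, x) \<in> A"
    unfolding saturates_def by blast
  have "inj_on (f \<circ> \<sigma> \<circ> inv f) (f ` X)"
    using \<sigma>(1) assms by (auto simp: inj_on_def inv_f_f)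
  moreover have "\<forall>x\<in>f ` X. ((f \<circ> \<sigma> \<circ> inv f) x, x) \<in> map_prod f f ` A"
    using \<sigma>(2) assms by (auto simp: inv_f_f intro: rev_image_eqI)
  ultimately show "saturates (map_prod f f ` A) (f ` X)"
    unfolding saturates_def by blast
next
  assume "saturates (map_prod f f ` A) (f ` X)"
  then obtain \<sigma> where \<sigma>: "inj_on \<sigma> (f ` X)" "\<forall>x\<in>X. (\<sigma> (f x), f x) \<in> map_prod f f ` A"
    unfolding saturates_def by auto
  then have *: "\<exists>y. \<sigma> (f x) = f y \<and> (y, x) \<in> A" if "x \<in> X" for x
    using that assms by (fastforce dest: injD)
  then have "\<exists>\<tau>. \<forall>x\<in>X. \<sigma> (f x) = f (\<tau> x) \<and> (\<tau> x, x) \<in> A" by metis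
  then obtain \<tau> where \<tau>: "\<forall>x\<in>X. \<sigma> (f x) = f (\<tau> x) \<and> (\<tau> x, x) \<in> A" by blast
  have "inj_on \<tau> X"
  proof (rule inj_onI)
    fix x y assume xy: "x \<in> X" "y \<in> X" "\<tau> x = \<tau> y"
    then have "\<sigma> (f x) = \<sigma> (f y)" using \<tau> by simp
    then have "f x = f y" using \<sigma>(1) xy by (auto dest: inj_onD)
    then show "x = y" using assms by (rule injD[rotated])
  qed
  with \<tau> show "saturates A X" unfolding saturates_def by blast
qed

text \<open>A list of bids records the latest bid first. The price of an item is the number of bids on it, and
  its owner is the latest bidder, so that \<^const>\<open>map_of\<close> gives the owners.\<close>

definition price :: "('b \<times> 'a) list \<Rightarrow> 'b \<Rightarrow> nat" where
  "price W y = count_list (map fst W) y"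

abbreviation free :: "('b \<times> 'a) list \<Rightarrow> 'a \<Rightarrow> bool" where
  "free W x \<equiv> x \<notin> ran (map_of W)"

text \<open>A bidder without an item bids for a cheapest one among those it may have, and thereby takes it
  from its owner.\<close>

definition biddable :: "('b \<times> 'a) set \<Rightarrow> ('b \<times> 'a) list \<Rightarrow> 'b \<times> 'a \<Rightarrow> bool" where
  "biddable A W = (\<lambda>(y, x). (y, x) \<in> A \<and> free W x \<and> (\<forall>y'. (y', x) \<in> A \<longrightarrow> price W y \<le> price W y'))"

inductive auction :: "('b \<times> 'a) set \<Rightarrow> ('b \<times> 'a) list \<Rightarrow> bool" for A where
  start: "auction A []"
| bid: "auction A W \<Longrightarrow> biddable A W b \<Longrightarrow> auction A (b # W)"

lemma price_Nil [simp]: "price [] y = 0"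
  and price_Cons [simp]: "price (b # W) y = (if fst b = y then Suc (price W y) else price W y)"
  by (simp_all add: price_def)

lemma auction_subset: "auction A W \<Longrightarrow> set W \<subseteq> A"
  by (induction rule: auction.induct) (auto simp: biddable_def)

lemma price_pos_iff: "0 < price W y \<longleftrightarrow> y \<in> dom (map_of W)"
  by (induction W) auto

lemma auction_owner_inj:
  "auction A W \<Longrightarrow> map_of W y = Some x \<Longrightarrow> map_of W y' = Some x \<Longrightarrow> y = y'"
  by (induction rule: auction.induct)
    (auto simp: biddable_def ranI split: if_splits)

text \<open>The invariant of the auction: a winner has paid at most one unit more than the present price
  of each other item it could bid for, since prices never fall.\<close>

lemma auction_price_le:
  "auction A W \<Longrightarrow> map_of W y = Some x \<Longrightarrow> (y', x) \<in> A \<Longrightarrow> price W y \<le> Suc (price W y')"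
  by (induction rule: auction.induct)
    (fastforce simp: biddable_def le_Suc_eq split: if_splits)+

text \<open>Let the items that a free bidder can bid for cost at least \<open>k\<close> each. The winners of the items
  of price at least \<open>j + 1\<close>, together with this bidder, can bid only for items of price at least
  \<open>j\<close>. By Hall's condition there is at least one more of the latter, for every \<open>j < k\<close>.\<close>

lemma auction_price_bound:
  assumes "auction A W" and "finite A" and "Range A \<subseteq> X" and "finite X" and "hall A X"
    and x: "x \<in> X" "free W x" and k: "\<And>y. (y, x) \<in> A \<Longrightarrow> k \<le> price W y"
  shows "k < card (Domain A)"
proof -
  define Z where "Z j = {y \<in> Domain A. j \<le> price W y}" for j
  have fin: "finite (Z j)" for j using assms(2) by (simp add: Z_def finite_Domain)
  have "Suc (k - j) \<le> card (Z j)" if "j \<le> k" for j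
    using that
  proof (induction rule: inc_induct)
    case base
    have "card {x} \<le> card (A\<inverse> `` {x})" using assms(5) x unfolding hall_def by blast
    also have "\<dots> \<le> card (Z k)" using fin k by (intro card_mono) (auto simp: Z_def)
    finally show ?case by simp
  next
    case (step j)
    define S where "S = {x'. \<exists>y \<in> Z (Suc j). map_of W y = Some x'}"
    have "\<exists>x'. map_of W y = Some x'" if "y \<in> Z (Suc j)" for y
      using that price_pos_iff[of W y] by (auto simp: Z_def)
    then obtain own where own: "\<And>y. y \<in> Z (Suc j) \<Longrightarrow> map_of W y = Some (own y)" by metis
    then have "S = own ` Z (Suc j)" by (force simp: S_def)
    moreover have "inj_on own (Z (Suc j))"
      using own auction_owner_inj[OF assms(1)] by (metis inj_onI)
    ultimately have S: "card S = card (Z (Suc j))" "finite S"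
      using fin by (simp_all add: card_image)
    have "x \<notin> S" using x(2) by (auto simp: S_def ran_def)
    have "S \<subseteq> X"
      using auction_subset[OF assms(1)] assms(3) by (auto simp: S_def dest!: map_of_SomeD)
    have "Suc (card (Z (Suc j))) = card (insert x S)"
      using S \<open>x \<notin> S\<close> by simp
    also have "\<dots> \<le> card (A\<inverse> `` insert x S)"
      using assms(5) x(1) \<open>S \<subseteq> X\<close> unfolding hall_def by blast
    also have "\<dots> \<le> card (Z j)"
    proof (intro card_mono fin subsetI)
      fix y assume "y \<in> A\<inverse> `` insert x S"
      then consider "(y, x) \<in> A" | x' where "x' \<in> S" "(y, x') \<in> A" by blast
      then show "y \<in> Z j"
      proof cases
        case 1
        then show ?thesis using k[of y] step.hyps by (auto simp: Z_def)
      next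
        case 2
        then obtain y' where "y' \<in> Z (Suc j)" "map_of W y' = Some x'" by (auto simp: S_def)
        with 2 auction_price_le[OF assms(1), of y' x' y] show ?thesis by (auto simp: Z_def)
      qed
    qed
    finally show ?case using step by linarith
  qed
  from this[of 0] have "k < card (Z 0)" by simp
  also have "\<dots> \<le> card (Domain A)"
    using assms(2) by (intro card_mono) (auto simp: Z_def finite_Domain)
  finally show ?thesis .
qed

text \<open>A price rises only from a value below the number of items, by the bound just shown.\<close>

lemma auction_length:
  assumes "auction A W" and "finite A" and "Range A \<subseteq> X" and "finite X" and "hall A X"
  shows "length W \<le> card (Domain A) * card (Domain A)"
proof -
  have le: "price W y \<le> card (Domain A)" for y
    using assms(1)
  proof (induction rule: auction.induct)
    case (bid W b)
    obtain y0 x where b: "b = (y0, x)" by (cases b)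
    have "price W y0 < card (Domain A)"
      using auction_price_bound[OF bid.hyps(1) assms(2-5), of x "price W y0"] bid.hyps(2) assms(3)
      by (auto simp: b biddable_def)
    with bid.IH show ?case by (auto simp: b)
  qed simp
  have "length W = length (map fst W)" by simp
  also have "\<dots> = (\<Sum>y\<in>set (map fst W). price W y)"
    unfolding price_def by (rule sum_count_set[symmetric]) auto
  also have "\<dots> \<le> (\<Sum>y\<in>Domain A. price W y)"
    using auction_subset[OF assms(1)] assms(2) by (intro sum_mono2) (force simp: finite_Domain)+
  also have "\<dots> \<le> (\<Sum>y\<in>Domain A. card (Domain A))" by (intro sum_mono le)
  finally show ?thesis by simp
qed

text \<open>As long as some bidder is free, it bids for a cheapest item.\<close>

lemma stuck_auction_saturates:
  assumes "auction A W" and "finite A" and "hall A X" and stuck: "\<nexists>b. biddable A W b"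
  shows "\<forall>x\<in>X. \<not> free W x"
proof
  fix x assume "x \<in> X"
  show "\<not> free W x"
  proof
    assume "free W x"
    have "card {x} \<le> card (A\<inverse> `` {x})" using assms(3) \<open>x \<in> X\<close> unfolding hall_def by blast
    then obtain y0 where "(y0, x) \<in> A" by (cases "A\<inverse> `` {x} = {}") auto
    then obtain y where "(y, x) \<in> A" "\<And>y'. (y', x) \<in> A \<Longrightarrow> price W y \<le> price W y'"
      using exists_least_iff[of "\<lambda>n. \<exists>y. (y, x) \<in> A \<and> price W y = n"] by (metis not_less)
    with \<open>free W x\<close> have "biddable A W (y, x)" by (simp add: biddable_def)
    with stuck show False by blast
  qed
qed

lemma all_won_imp_saturates:
  assumes "set W \<subseteq> A" and "\<forall>x\<in>X. \<not> free W x"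
  shows "saturates A X"
proof -
  from assms(2) have "\<forall>x\<in>X. \<exists>y. map_of W y = Some x" by (auto simp: ran_def)
  then obtain \<sigma> where \<sigma>: "\<And>x. x \<in> X \<Longrightarrow> map_of W (\<sigma> x) = Some x" by metis
  then have "inj_on \<sigma> X" by (metis inj_onI option.inject)
  moreover have "(\<sigma> x, x) \<in> A" if "x \<in> X" for x
    using \<sigma>[OF that] assms(1) by (auto dest: map_of_SomeD)
  ultimately show ?thesis unfolding saturates_def by blast
qed

text \<open>A longest auction exists because the lengths are bounded; nobody can bid any more at its end.\<close>

theorem hall_imp_saturates:
  assumes "finite A" and "Range A \<subseteq> X" and "finite X" and "hall A X"
  shows "saturates A X"
proof -
  have "\<forall>W. auction A W \<longrightarrow> length W < Suc (card (Domain A) * card (Domain A))"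
    using auction_length assms le_imp_less_Suc by blast
  then obtain W where W: "auction A W" "\<And>W'. auction A W' \<Longrightarrow> length W' \<le> length W"
    using ex_has_greatest_nat[of "auction A" "[]" length] auction.start by (metis less_imp_le)
  have "\<nexists>b. biddable A W b"
    using W(2) auction.bid[OF W(1)] by (metis Suc_n_not_le_n length_Cons)
  then show ?thesis
    using stuck_auction_saturates[OF W(1) assms(1,4)] all_won_imp_saturates auction_subset W(1)
    by blast
qed


section \<open>Exact matchings as matchings with prescribed degrees\<close>

text \<open>Left summands name the vertices themselves, right summands the dummies; the dummies of \<open>t\<close> are
  copies of the elements of \<open>W t\<close>, a subset of \<open>U t\<close>. A dummy of \<open>t\<close> stands for leaving a vertex of
  \<open>U t\<close> unmatched. Each edge gives an arc in both directions, so that both sides of the bipartition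
  take part as bidders and as items, and an assignment can be sought without knowing the sides.\<close>

definition dummy_arcs :: "'t set \<Rightarrow> 't set set \<Rightarrow> ('t \<Rightarrow> 'v set) \<Rightarrow> ('t set \<Rightarrow> 'v set set) \<Rightarrow>
    ('t \<Rightarrow> 'v set) \<Rightarrow> (('v + 'v) \<times> ('v + 'v)) set" where
  "dummy_arcs V E U H W =
     {(Inl x, Inl y) | x y. \<exists>e\<in>E. {x, y} \<in> H e} \<union>
     {(Inl x, Inr z) | x z. \<exists>t\<in>V. x \<in> U t \<and> z \<in> W t} \<union>
     {(Inr z, Inl x) | x z. \<exists>t\<in>V. x \<in> U t \<and> z \<in> W t}"

definition dummy_vertices :: "'t set \<Rightarrow> ('t \<Rightarrow> 'v set) \<Rightarrow> ('t \<Rightarrow> 'v set) \<Rightarrow> ('v + 'v) set" where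
  "dummy_vertices V U W = Inl ` (\<Union>t\<in>V. U t) \<union> Inr ` (\<Union>t\<in>V. W t)"

text \<open>For the weights \<open>q\<close>, this is the number of vertices of \<open>U t\<close> that an exact matching covers.\<close>

definition colour_degree :: "'t set set \<Rightarrow> ('t set \<Rightarrow> nat) \<Rightarrow> 't \<Rightarrow> nat" where
  "colour_degree E m t = (\<Sum>e\<in>{e \<in> E. t \<in> e}. m e)"

lemma sum_degrees:
  assumes "finite P" and "finite E"
  shows "(\<Sum>t\<in>P. colour_degree E m t) = (\<Sum>e\<in>E. m e * card (P \<inter> e))"
proof -
  have "(\<Sum>t\<in>P. colour_degree E m t) = (\<Sum>e\<in>E. \<Sum>t\<in>{t. t \<in> P \<and> t \<in> e}. m e)"
    unfolding colour_degree_def by (rule sum.swap_restrict[OF assms])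
  then show ?thesis by (simp add: mult.commute Int_def)
qed

lemma matching_unique: "matching M \<Longrightarrow> g \<in> M \<Longrightarrow> h \<in> M \<Longrightarrow> x \<in> g \<Longrightarrow> x \<in> h \<Longrightarrow> g = h"
  unfolding matching_def disjoint_def by blast

lemma finite_matchings: "finite S \<Longrightarrow> finite {M. M \<subseteq> S \<and> matching M}"
  by (rule finite_subset[of _ "Pow S"]) auto

lemma card_matching_le: "finite S \<Longrightarrow> M \<subseteq> S \<Longrightarrow> matching M \<Longrightarrow> card M \<le> \<nu> S"
  unfolding matching_number_def using finite_matchings by (intro Max_ge) auto

lemma maximum_matching:
  assumes "finite S"
  obtains M where "M \<subseteq> S" "matching M" "card M = \<nu> S"
proof -
  have "{} \<in> {M. M \<subseteq> S \<and> matching M}" by (simp add: matching_def)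
  then have "\<nu> S \<in> card ` {M. M \<subseteq> S \<and> matching M}"
    unfolding matching_number_def using finite_matchings[OF assms] by (intro Max_in) auto
  then show thesis using that by auto
qed

text \<open>The edges of a matching are covered by different elements of \<open>C\<close>.\<close>

lemma matching_number_le_cover:
  assumes "finite S" and "finite C" and "\<And>h. h \<in> S \<Longrightarrow> h \<inter> C \<noteq> {}"
  shows "\<nu> S \<le> card C"
proof -
  from maximum_matching[OF assms(1)] obtain M where M: "M \<subseteq> S" "matching M" "card M = \<nu> S" .
  then have "\<forall>h\<in>M. \<exists>c. c \<in> h \<inter> C" using assms(3) by blast
  then obtain f where f: "\<And>h. h \<in> M \<Longrightarrow> f h \<in> h \<inter> C" by metis
  then have "inj_on f M"
    using M(2) unfolding matching_def disjoint_def inj_on_def by (metis IntD1 IntI empty_iff)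
  with f assms(2) have "card M \<le> card C" by (intro card_inj_on_le[of f]) auto
  with M(3) show ?thesis by simp
qed

context tree_colour_classes
begin

lemma finite_V: "finite V" and tree_edge: "e \<in> E \<Longrightarrow> \<exists>t u. t \<in> V \<and> u \<in> V \<and> t \<noteq> u \<and> e = {t, u}"
  using tree unfolding finite_tree_def finite_simple_graph_def by auto

lemma finite_E: "finite E"
  by (rule finite_subset[of _ "Pow V"]) (use tree_edge finite_V in auto)

lemma forest_E: "forest E"
  using tree tree_edge finite_E unfolding forest_def finite_tree_def by blast

lemma same_class: "x \<in> U t \<Longrightarrow> x \<in> U u \<Longrightarrow> t \<in> V \<Longrightarrow> u \<in> V \<Longrightarrow> t = u"
  using disjoint_U unfolding disjoint_family_on_def by blast

lemma H_edge:
  assumes "e \<in> E" and "h \<in> H e"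
  obtains t u x y where "t \<in> V" "u \<in> V" "t \<noteq> u" "e = {t, u}" "x \<in> U t" "y \<in> U u" "h = {x, y}" "x \<noteq> y"
proof -
  from tree_edge[OF assms(1)] obtain t u where tu: "t \<in> V" "u \<in> V" "t \<noteq> u" "e = {t, u}" by blast
  with bipartite_H assms obtain x y where "x \<in> U t" "y \<in> U u" "h = {x, y}" by blast
  moreover from this have "x \<noteq> y" using same_class tu by blast
  ultimately show thesis using that tu by blast
qed

lemma card_H_edge_Int_class:
  assumes "e \<in> E" and "h \<in> H e" and "t \<in> V"
  shows "card (h \<inter> U t) = (if t \<in> e then 1 else 0)"
proof -
  obtain a b x y where ab: "a \<in> V" "b \<in> V" "a \<noteq> b" "e = {a, b}" "x \<in> U a" "y \<in> U b" "h = {x, y}"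
    using H_edge[OF assms(1,2)] by metis
  have "x \<in> U t \<longleftrightarrow> t = a" "y \<in> U t \<longleftrightarrow> t = b"
    using ab assms(3) same_class by blast+
  with ab have "h \<inter> U t = (if t = a then {x} else if t = b then {y} else {})" by auto
  with ab show ?thesis by simp
qed

lemma H_disjoint:
  assumes "e \<in> E" "f \<in> E" "h \<in> H e" "h \<in> H f"
  shows "e = f"
proof -
  have "e \<subseteq> V" "f \<subseteq> V" using assms(1,2) tree_edge by blast+
  moreover have "t \<in> e \<longleftrightarrow> t \<in> f" if "t \<in> V" for t
    using card_H_edge_Int_class[OF assms(1,3) that] card_H_edge_Int_class[OF assms(2,4) that]
    by (metis zero_neq_one)
  ultimately show ?thesis by blast
qed

lemma finite_H: "e \<in> E \<Longrightarrow> finite (H e)"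
proof (rule finite_subset[of _ "Pow (\<Union>t\<in>V. U t)"])
  show "H e \<subseteq> Pow (\<Union>t\<in>V. U t)" if "e \<in> E"
  proof
    fix h assume "h \<in> H e"
    from H_edge[OF that this] show "h \<in> Pow (\<Union>t\<in>V. U t)" by blast
  qed
qed (use finite_V finite_U in auto)

lemma sum_colours:
  assumes "F \<subseteq> E" and "M \<subseteq> (\<Union>e\<in>F. H e)"
  shows "(\<Sum>h\<in>M. g h) = (\<Sum>e\<in>F. \<Sum>h\<in>M \<inter> H e. g h)"
proof -
  have "(\<Sum>h\<in>(\<Union>e\<in>F. M \<inter> H e). g h) = (\<Sum>e\<in>F. \<Sum>h\<in>M \<inter> H e. g h)"
  proof (rule sum.UNION_disjoint)
    show "finite F" using assms(1) finite_E finite_subset by blast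
    show "\<forall>e\<in>F. finite (M \<inter> H e)" using assms(1) finite_H by blast
    show "\<forall>e\<in>F. \<forall>f\<in>F. e \<noteq> f \<longrightarrow> M \<inter> H e \<inter> (M \<inter> H f) = {}" using assms(1) H_disjoint by blast
  qed
  moreover have "(\<Union>e\<in>F. M \<inter> H e) = M" using assms(2) by blast
  ultimately show ?thesis by simp
qed

text \<open>A matching edge of colour \<open>e\<close> covers one vertex of \<open>U t\<close> if \<open>t\<close> is an end of \<open>e\<close>, and none
  otherwise.\<close>

lemma card_covered:
  assumes "matching M" and "M \<subseteq> (\<Union>e\<in>E. H e)" and "t \<in> V"
  shows "card (U t \<inter> \<Union>M) = colour_degree E (\<lambda>e. card (M \<inter> H e)) t"
proof -
  have fM: "finite M" using assms(2) finite_E finite_H by (meson finite_UN finite_subset)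
  have "card (U t \<inter> \<Union>M) = card (\<Union>h\<in>M. h \<inter> U t)" by (rule arg_cong[of _ _ card]) blast
  also have "\<dots> = (\<Sum>h\<in>M. card (h \<inter> U t))"
    using fM finite_U[OF assms(3)] matching_unique[OF assms(1)]
    by (intro card_UN_disjoint) blast+
  also have "\<dots> = (\<Sum>e\<in>E. \<Sum>h\<in>M \<inter> H e. card (h \<inter> U t))"
    by (rule sum_colours) (use assms(2) in auto)
  also have "\<dots> = (\<Sum>e\<in>E. if t \<in> e then card (M \<inter> H e) else 0)"
  proof (rule sum.cong[OF refl])
    fix e assume "e \<in> E"
    have "(\<Sum>h\<in>M \<inter> H e. card (h \<inter> U t)) = (\<Sum>h\<in>M \<inter> H e. if t \<in> e then 1 else 0)"
      using card_H_edge_Int_class[OF \<open>e \<in> E\<close> _ assms(3)] by (intro sum.cong) auto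
    then show "(\<Sum>h\<in>M \<inter> H e. card (h \<inter> U t)) = (if t \<in> e then card (M \<inter> H e) else 0)"
      by simp
  qed
  also have "\<dots> = colour_degree E (\<lambda>e. card (M \<inter> H e)) t"
    unfolding colour_degree_def using finite_E by (intro sum.inter_filter[symmetric])
  finally show ?thesis .
qed

lemma exact_matching_imp_degrees:
  assumes "exact_matching E H q M" and "t \<in> V"
  shows "card (U t \<inter> \<Union>M) = colour_degree E q t"
proof -
  have "card (U t \<inter> \<Union>M) = colour_degree E (\<lambda>e. card (M \<inter> H e)) t"
    using assms card_covered unfolding exact_matching_def by blast
  also have "\<dots> = colour_degree E q t"
    using assms(1) unfolding exact_matching_def colour_degree_def by (intro sum.cong) auto
  finally show ?thesis .
qed

text \<open>The numbers of covered vertices determine the numbers of edges of each colour, because the tree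
  is a forest. This turns the demands on colours into demands on vertex classes.\<close>

lemma degrees_imp_exact_matching:
  assumes "matching M" and "M \<subseteq> (\<Union>e\<in>E. H e)" and "\<And>t. t \<in> V \<Longrightarrow> card (U t \<inter> \<Union>M) = colour_degree E q t"
  shows "exact_matching E H q M"
proof -
  have "colour_degree E (\<lambda>e. card (M \<inter> H e)) t = colour_degree E q t" for t
  proof (cases "t \<in> V")
    case True
    with assms card_covered show ?thesis by metis
  next
    case False
    then have "{e \<in> E. t \<in> e} = {}" using tree_edge by blast
    then show ?thesis unfolding colour_degree_def by (metis sum.empty)
  qed
  then have "card (M \<inter> H e) = q e" if "e \<in> E" for e
    using forest_degrees_determine_weights[OF forest_E _ that, of "\<lambda>e. card (M \<inter> H e)" q]
    by (simp add: colour_degree_def)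
  with assms(1,2) show ?thesis unfolding exact_matching_def by blast
qed

lemma exact_matching_imp_matching_number:
  assumes "exact_matching E H q M" and "F \<subseteq> E"
  shows "(\<Sum>e\<in>F. q e) \<le> \<nu> (\<Union>e\<in>F. H e)"
proof -
  let ?M = "M \<inter> (\<Union>e\<in>F. H e)"
  have "(\<Sum>e\<in>F. q e) = (\<Sum>e\<in>F. card (M \<inter> H e))"
    using assms unfolding exact_matching_def by (intro sum.cong) auto
  also have "\<dots> = (\<Sum>e\<in>F. \<Sum>h\<in>?M \<inter> H e. 1)"
    by (intro sum.cong) (auto intro: arg_cong[of _ _ card])
  also have "\<dots> = card ?M"
    using sum_colours[OF assms(2), of ?M "\<lambda>_. 1::nat"] by simp
  also have "\<dots> \<le> \<nu> (\<Union>e\<in>F. H e)"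
  proof (rule card_matching_le)
    show "finite (\<Union>e\<in>F. H e)"
      using assms(2) finite_E finite_H by (meson finite_UN finite_subset subset_iff)
    show "matching ?M" using assms(1) unfolding exact_matching_def matching_def disjoint_def by blast
  qed simp
  finally show ?thesis .
qed

lemma exact_matching_bounds:
  assumes "exact_matching E H q M"
  shows "t \<in> V \<Longrightarrow> colour_degree E q t \<le> card (U t)" and "e \<in> E \<Longrightarrow> q e \<le> card (H e)"
proof -
  show "colour_degree E q t \<le> card (U t)" if "t \<in> V"
    using exact_matching_imp_degrees[OF assms that] card_mono[OF finite_U[OF that] Int_lower1]
    by metis
  show "q e \<le> card (H e)" if "e \<in> E"
    using assms that card_mono[OF finite_H[OF that] Int_lower2] unfolding exact_matching_def by metis
qed

text \<open>\<open>U t\<close> covers the edges of all colours at \<open>t\<close>, so that the assumption for these colours gives the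
  bound. Owing to it, the subtraction in the number of dummies of \<open>t\<close> is not truncated.\<close>

lemma degree_le_card_class:
  assumes "\<forall>F\<subseteq>E. (\<Sum>e\<in>F. q e) \<le> \<nu> (\<Union>e\<in>F. H e)" and "t \<in> V"
  shows "colour_degree E q t \<le> card (U t)"
proof -
  have "colour_degree E q t \<le> \<nu> (\<Union>e\<in>{e \<in> E. t \<in> e}. H e)"
    unfolding colour_degree_def by (rule assms(1)[rule_format]) blast
  also have "\<dots> \<le> card (U t)"
  proof (rule matching_number_le_cover)
    show "finite (\<Union>e\<in>{e \<in> E. t \<in> e}. H e)" using finite_E finite_H by auto
    show "finite (U t)" using finite_U assms(2) by blast
    fix h assume "h \<in> (\<Union>e\<in>{e \<in> E. t \<in> e}. H e)"
    then obtain e where "e \<in> E" "t \<in> e" "h \<in> H e" by blast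
    then have "card (h \<inter> U t) = 1" using card_H_edge_Int_class assms(2) by simp
    then show "h \<inter> U t \<noteq> {}" by auto
  qed
  finally show ?thesis .
qed

end

locale tree_colour_classes_with_dummies = tree_colour_classes V E U H q
  for V :: "'t set" and E and U :: "'t \<Rightarrow> 'v set" and H q +
  fixes W :: "'t \<Rightarrow> 'v set"
  assumes W_sub: "t \<in> V \<Longrightarrow> W t \<subseteq> U t"
    and card_W: "t \<in> V \<Longrightarrow> card (W t) + colour_degree E q t = card (U t)"
begin

abbreviation A where "A \<equiv> dummy_arcs V E U H W"

lemma finite_arcs: "finite A"
proof (rule finite_subset)
  let ?X = "Inl ` (\<Union>t\<in>V. U t) \<union> Inr ` (\<Union>t\<in>V. U t) :: ('v + 'v) set"
  have ends: "x \<in> (\<Union>t\<in>V. U t) \<and> y \<in> (\<Union>t\<in>V. U t)" if "e \<in> E" "{x, y} \<in> H e" for e x y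
  proof -
    from H_edge[OF that] obtain t u a b
      where "t \<in> V" "u \<in> V" "a \<in> U t" "b \<in> U u" "{x, y} = {a, b}" by metis
    then show ?thesis by (auto simp: doubleton_eq_iff)
  qed
  show "A \<subseteq> ?X \<times> ?X"
  proof
    fix a assume "a \<in> A"
    then consider x y e where "a = (Inl x, Inl y)" "e \<in> E" "{x, y} \<in> H e"
      | x z t where "a = (Inl x, Inr z) \<or> a = (Inr z, Inl x)" "t \<in> V" "x \<in> U t" "z \<in> W t"
      unfolding dummy_arcs_def by blast
    then show "a \<in> ?X \<times> ?X"
    proof cases
      case 1
      with ends[OF 1(2,3)] show ?thesis by simp
    next
      case 2
      then have "x \<in> (\<Union>t\<in>V. U t)" "z \<in> (\<Union>t\<in>V. U t)" using W_sub by blast+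
      with 2(1) show ?thesis by auto
    qed
  qed
  show "finite (?X \<times> ?X)" using finite_V finite_U by simp
qed

lemma finite_W: "t \<in> V \<Longrightarrow> finite (W t)"
  using W_sub finite_U finite_subset by blast

text \<open>Each vertex is assigned to its partner in the matching, or else to a dummy; the dummies are
  assigned back. This is injective as it is an involution.\<close>

lemma exact_matching_imp_saturates:
  assumes M: "exact_matching E H q M"
  shows "saturates A (dummy_vertices V U W)"
proof -
  have M': "matching M" "M \<subseteq> (\<Union>e\<in>E. H e)" using M unfolding exact_matching_def by auto
  have "\<exists>b. bij_betw b (U t - \<Union>M) (W t)" if "t \<in> V" for t
  proof (rule finite_same_card_bij)
    have "card (U t - \<Union>M) = card (U t) - card (U t \<inter> \<Union>M)"
      using finite_U[OF that] by (simp add: card_Diff_subset_Int)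
    then show "card (U t - \<Union>M) = card (W t)"
      using exact_matching_imp_degrees[OF M that] card_W[OF that] by simp
  qed (use finite_U finite_W that in auto)
  then obtain b where b: "\<And>t. t \<in> V \<Longrightarrow> bij_betw (b t) (U t - \<Union>M) (W t)" by metis
  define cl where "cl x = (THE t. t \<in> V \<and> x \<in> U t)" for x
  have cl: "cl x = t" if "t \<in> V" "x \<in> U t" for x t
    unfolding cl_def using that same_class by (intro the_equality) blast+
  define mate where "mate x = (THE y. {x, y} \<in> M)" for x
  have mate: "mate x = y" if "{x, y} \<in> M" for x y
  proof -
    have "y' = y" if "{x, y'} \<in> M" for y'
    proof -
      have "{x, y'} = {x, y}"
        using matching_unique[OF M'(1) that \<open>{x, y} \<in> M\<close>, of x] by simp
      then show ?thesis by (auto simp: doubleton_eq_iff)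
    qed
    with that show ?thesis unfolding mate_def by blast
  qed
  define \<sigma> where "\<sigma> v = (case v of
      Inl x \<Rightarrow> if x \<in> \<Union>M then Inl (mate x) else Inr (b (cl x) x)
    | Inr z \<Rightarrow> Inl (inv_into (U (cl z) - \<Union>M) (b (cl z)) z))" for v
  have arc_and_involution: "(\<sigma> v, v) \<in> A \<and> \<sigma> (\<sigma> v) = v" if "v \<in> dummy_vertices V U W" for v
  proof -
    consider x t where "v = Inl x" "t \<in> V" "x \<in> U t" "x \<in> \<Union>M"
      | x t where "v = Inl x" "t \<in> V" "x \<in> U t" "x \<notin> \<Union>M"
      | z t where "v = Inr z" "t \<in> V" "z \<in> W t"
      using \<open>v \<in> dummy_vertices V U W\<close> unfolding dummy_vertices_def by blast
    then show ?thesis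
    proof cases
      case (1 x t)
      then obtain h e where h: "x \<in> h" "h \<in> M" "e \<in> E" "h \<in> H e" using M'(2) by blast
      then obtain y where y: "h = {x, y}" using H_edge[OF h(3,4)] by (metis insertE insert_commute singletonD)
      then have "mate x = y" "mate y = x" "y \<in> \<Union>M"
        using h mate[of x y] mate[of y x] by (auto simp: insert_commute)
      with 1 h y show ?thesis
        unfolding \<sigma>_def dummy_arcs_def by (auto simp: insert_commute)
    next
      case (2 x t)
      let ?z = "b t x"
      have z: "?z \<in> W t" using b[OF 2(2)] 2(3,4) bij_betwE by fastforce
      have "cl ?z = t" using cl z W_sub 2(2) by blast
      moreover have "inv_into (U t - \<Union>M) (b t) ?z = x"
        using b[OF 2(2)] 2(3,4) by (intro inv_into_f_f) (auto simp: bij_betw_def)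
      ultimately have "\<sigma> (\<sigma> v) = v" using 2 cl by (simp add: \<sigma>_def)
      moreover have "(\<sigma> v, v) \<in> A" using 2 z cl by (auto simp: \<sigma>_def dummy_arcs_def)
      ultimately show ?thesis by blast
    next
      case (3 z t)
      then have "cl z = t" using cl W_sub by blast
      let ?x = "inv_into (U t - \<Union>M) (b t) z"
      have im: "z \<in> b t ` (U t - \<Union>M)" using b[OF 3(2)] 3(3) by (simp add: bij_betw_def)
      have x: "?x \<in> U t - \<Union>M" "b t ?x = z"
        by (rule inv_into_into[OF im], rule f_inv_into_f[OF im])
      have "cl ?x = t" using x(1) cl 3(2) by blast
      with x \<open>cl z = t\<close> 3 show ?thesis
        by (auto simp: \<sigma>_def dummy_arcs_def)
    qed
  qed
  then have "inj_on \<sigma> (dummy_vertices V U W)" by (metis inj_onI)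
  with arc_and_involution show ?thesis unfolding saturates_def by blast
qed

text \<open>One side of the bipartition: the classes on the one side, and the dummies of the others.\<close>

definition side_vertices :: "('t \<Rightarrow> bool) \<Rightarrow> ('v + 'v) set" where
  "side_vertices s = Inl ` (\<Union>t\<in>{t\<in>V. s t}. U t) \<union> Inr ` (\<Union>t\<in>{t\<in>V. \<not> s t}. W t)"

text \<open>The vertices that are not assigned to dummies form a matching. It covers at least as many
  vertices as demanded of each class on the side that is assigned, and at most as many of each
  other class; comparing totals shows that it covers the right number everywhere.\<close>

lemma saturates_side_imp_exact_matching:
  assumes sat: "saturates A (side_vertices s)" and s: "\<And>t u. {t, u} \<in> E \<Longrightarrow> s t \<noteq> s u"
  shows "\<exists>M. exact_matching E H q M"
proof -
  have edge_sides: "\<exists>t u. t \<in> V \<and> u \<in> V \<and> e = {t, u} \<and> s t \<and> \<not> s u" if e: "e \<in> E" for e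
  proof -
    from tree_edge[OF e] obtain t u where "t \<in> V" "u \<in> V" "e = {t, u}" by blast
    with s[of t u] e show ?thesis by (cases "s t") (auto simp: insert_commute)
  qed
  from sat obtain \<sigma> where inj: "inj_on \<sigma> (side_vertices s)"
    and arc: "\<And>v. v \<in> side_vertices s \<Longrightarrow> (\<sigma> v, v) \<in> A"
    unfolding saturates_def by blast
  have side_Inl: "Inl x \<in> side_vertices s \<longleftrightarrow> (\<exists>t\<in>V. s t \<and> x \<in> U t)"
    and side_Inr: "Inr x \<in> side_vertices s \<longleftrightarrow> (\<exists>t\<in>V. \<not> s t \<and> x \<in> W t)" for x
    unfolding side_vertices_def by auto
  define M where "M = {{x, y} | x y. Inl x \<in> side_vertices s \<and> \<sigma> (Inl x) = Inl y}"
  have edge: "\<exists>u\<in>V. \<not> s u \<and> y \<in> U u \<and> {x, y} \<in> (\<Union>e\<in>E. H e)"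
    if x: "Inl x \<in> side_vertices s" "\<sigma> (Inl x) = Inl y" for x y
  proof -
    from arc[OF x(1)] x(2) obtain e where e: "e \<in> E" "{x, y} \<in> H e"
      unfolding dummy_arcs_def by (auto simp: insert_commute)
    from x(1) obtain t where t: "t \<in> V" "s t" "x \<in> U t" unfolding side_Inl by blast
    from H_edge[OF e] obtain a b a' b' where ab: "a \<in> V" "b \<in> V" "e = {a, b}" "a' \<in> U a" "b' \<in> U b"
      "{x, y} = {a', b'}" by metis
    have "s a \<noteq> s b" using s e(1) ab(3) by blast
    from ab(6) consider "x = a'" "y = b'" | "x = b'" "y = a'" by (auto simp: doubleton_eq_iff)
    then show ?thesis
    proof cases
      case 1
      then have "a = t" using same_class ab t by blast
      with 1 ab \<open>s a \<noteq> s b\<close> t e show ?thesis by blast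
    next
      case 2
      then have "b = t" using same_class ab t by blast
      with 2 ab \<open>s a \<noteq> s b\<close> t e show ?thesis by blast
    qed
  qed
  have M_sub: "M \<subseteq> (\<Union>e\<in>E. H e)" unfolding M_def using edge by blast
  have "matching M" unfolding matching_def
  proof (rule disjointI, rule ccontr)
    fix g h assume "g \<in> M" "h \<in> M" "g \<noteq> h" and meet: "g \<inter> h \<noteq> {}"
    then obtain x y x' y' where g: "g = {x, y}" "Inl x \<in> side_vertices s" "\<sigma> (Inl x) = Inl y"
      and h: "h = {x', y'}" "Inl x' \<in> side_vertices s" "\<sigma> (Inl x') = Inl y'"
      unfolding M_def by auto
    from edge[OF g(2,3)] edge[OF h(2,3)] have "x \<noteq> y'" "x' \<noteq> y"
      using g(2) h(2) same_class unfolding side_Inl by blast+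
    with meet g(1) h(1) consider "x = x'" | "y = y'" by auto
    then have "x = x'"
      using g(3) h(3) inj_onD[OF inj _ g(2) h(2)] by cases auto
    with g h \<open>g \<noteq> h\<close> show False by simp
  qed
  let ?m = "\<lambda>e. card (M \<inter> H e)"
  \<comment> \<open>At most \<open>card (W t)\<close> vertices of \<open>U t\<close> are assigned to dummies.\<close>
  have ge: "colour_degree E q t \<le> colour_degree E ?m t" if t: "t \<in> V" "s t" for t
  proof -
    have "card (U t - \<Union>M) \<le> card (Inr ` W t :: ('v + 'v) set)"
    proof (rule card_inj_on_le)
      show "inj_on (\<sigma> \<circ> Inl) (U t - \<Union>M)"
        using inj t unfolding inj_on_def side_Inl by (metis comp_apply Diff_iff old.sum.inject(1) side_Inl)
      show "(\<sigma> \<circ> Inl) ` (U t - \<Union>M) \<subseteq> Inr ` W t"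
      proof
        fix w assume "w \<in> (\<sigma> \<circ> Inl) ` (U t - \<Union>M)"
        then obtain x where x: "x \<in> U t" "x \<notin> \<Union>M" "w = \<sigma> (Inl x)" by auto
        then have v: "Inl x \<in> side_vertices s" using t side_Inl by blast
        show "w \<in> Inr ` W t"
        proof (cases w)
          case (Inl y)
          with v x(3) have "{x, y} \<in> M"
            unfolding M_def mem_Collect_eq by (intro exI[of _ x] exI[of _ y]) auto
          with x(2) show ?thesis by blast
        next
          case (Inr z)
          with arc[OF v] x(3) have "\<exists>u\<in>V. x \<in> U u \<and> z \<in> W u" unfolding dummy_arcs_def by auto
          with Inr x(1) t(1) same_class show ?thesis by blast
        qed
      qed
    qed (use finite_W t in auto)
    then have "card (U t - \<Union>M) \<le> card (W t)" by (simp add: card_image)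
    moreover have "card (U t - \<Union>M) + card (U t \<inter> \<Union>M) = card (U t)"
      using finite_U[OF t(1)] by (metis Int_Diff_Un Int_Diff_disjoint add.commute card_Un_disjoint finite_Diff finite_Int)
    ultimately show ?thesis
      using card_W[OF t(1)] card_covered[OF \<open>matching M\<close> M_sub t(1)] by linarith
  qed
  \<comment> \<open>The dummies of \<open>t\<close> take \<open>card (W t)\<close> vertices of \<open>U t\<close>.\<close>
  have le: "colour_degree E ?m t \<le> colour_degree E q t" if t: "t \<in> V" "\<not> s t" for t
  proof -
    have "card (Inr ` W t :: ('v + 'v) set) \<le> card (Inl ` (U t - \<Union>M) :: ('v + 'v) set)"
    proof (rule card_inj_on_le)
      have sub: "Inr ` W t \<subseteq> side_vertices s" using t side_Inr by blast
      show "inj_on \<sigma> (Inr ` W t)" using inj sub by (rule inj_on_subset)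
      show "\<sigma> ` Inr ` W t \<subseteq> Inl ` (U t - \<Union>M)"
      proof
        fix w assume "w \<in> \<sigma> ` Inr ` W t"
        then obtain z where z: "z \<in> W t" "w = \<sigma> (Inr z)" by auto
        then have v: "Inr z \<in> side_vertices s" using sub by blast
        from arc[OF v] obtain y u where y: "w = Inl y" "u \<in> V" "y \<in> U u" "z \<in> W u"
          unfolding dummy_arcs_def z(2) by auto
        then have "u = t" using same_class z(1) t(1) W_sub by blast
        have "y \<notin> \<Union>M"
        proof
          assume "y \<in> \<Union>M"
          then obtain a c where a: "Inl a \<in> side_vertices s" "\<sigma> (Inl a) = Inl c" "y = a \<or> y = c"
            unfolding M_def by auto
          from a(3) show False
          proof
            assume "y = a"
            with a(1) y \<open>u = t\<close> t same_class show False unfolding side_Inl by blast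
          next
            assume "y = c"
            with a(2) y(1) z(2) inj_onD[OF inj _ a(1) v] show False by simp
          qed
        qed
        with y \<open>u = t\<close> show "w \<in> Inl ` (U t - \<Union>M)" by blast
      qed
    qed (use finite_U t in auto)
    then have "card (W t) \<le> card (U t - \<Union>M)" by (simp add: card_image)
    moreover have "card (U t - \<Union>M) + card (U t \<inter> \<Union>M) = card (U t)"
      using finite_U[OF t(1)] by (metis Int_Diff_Un Int_Diff_disjoint add.commute card_Un_disjoint finite_Diff finite_Int)
    ultimately show ?thesis
      using card_W[OF t(1)] card_covered[OF \<open>matching M\<close> M_sub t(1)] by linarith
  qed
  \<comment> \<open>Both sides have the same degree sum, so that all these inequalities are equations.\<close>
  have one_end: "card ({t\<in>V. s t} \<inter> e) = 1" "card ({t\<in>V. \<not> s t} \<inter> e) = 1" if "e \<in> E" for e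
  proof -
    from edge_sides[OF that] obtain t u where "t \<in> V" "u \<in> V" "e = {t, u}" "s t" "\<not> s u" by blast
    then have "{t\<in>V. s t} \<inter> e = {t}" "{t\<in>V. \<not> s t} \<inter> e = {u}" by auto
    then show "card ({t\<in>V. s t} \<inter> e) = 1" "card ({t\<in>V. \<not> s t} \<inter> e) = 1" by simp_all
  qed
  then have sums: "(\<Sum>t\<in>{t\<in>V. s t}. colour_degree E m t) = sum m E"
    "(\<Sum>t\<in>{t\<in>V. \<not> s t}. colour_degree E m t) = sum m E" for m
    using finite_V finite_E by (simp_all add: sum_degrees)
  have "(\<Sum>t\<in>{t\<in>V. s t}. colour_degree E q t) \<le> (\<Sum>t\<in>{t\<in>V. s t}. colour_degree E ?m t)"
    using ge by (intro sum_mono) auto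
  moreover have "(\<Sum>t\<in>{t\<in>V. \<not> s t}. colour_degree E ?m t) \<le> (\<Sum>t\<in>{t\<in>V. \<not> s t}. colour_degree E q t)"
    using le by (intro sum_mono) auto
  ultimately have sum_eq: "sum q E = sum ?m E" unfolding sums by simp
  have eq: "colour_degree E ?m t = colour_degree E q t" if "t \<in> V" for t
  proof (cases "s t")
    case True
    have "colour_degree E q t = colour_degree E ?m t"
      by (rule sum_mono_inv[of "colour_degree E q" "{t\<in>V. s t}" "colour_degree E ?m"])
        (use sums sum_eq ge finite_V that True in auto)
    then show ?thesis by simp
  next
    case False
    show ?thesis
      by (rule sum_mono_inv[of "colour_degree E ?m" "{t\<in>V. \<not> s t}" "colour_degree E q"])
        (use sums sum_eq le finite_V that False in auto)
  qed
  have "exact_matching E H q M"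
    by (rule degrees_imp_exact_matching[OF \<open>matching M\<close> M_sub])
      (simp add: card_covered[OF \<open>matching M\<close> M_sub] eq)
  then show ?thesis by blast
qed

lemma side_vertices_subset: "side_vertices s \<subseteq> dummy_vertices V U W"
  unfolding side_vertices_def dummy_vertices_def by blast

text \<open>The two directions fit together because an assignment of all vertices and dummies restricts to one
  for a single side of the bipartition.\<close>

theorem exact_matching_iff_saturates:
  "(\<exists>M. exact_matching E H q M) \<longleftrightarrow> saturates A (dummy_vertices V U W)"
  using exact_matching_imp_saturates saturates_side_imp_exact_matching
    saturates_subset[OF _ side_vertices_subset] forest_bipartition[OF forest_E]
  by metis

text \<open>Let \<open>P\<close> be the classes that meet \<open>S\<close> and \<open>Q\<close> those of which \<open>S\<close> contains a dummy. The
  colours between \<open>P\<close> and the complement of \<open>Q\<close> are covered by the vertices of \<open>P\<close> outside \<open>S\<close>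
  and the neighbours of \<open>S\<close>, so that there are at least as many of these as \<open>q\<close> demands; and the
  demand is at least the difference of the degree sums over \<open>P\<close> and \<open>Q\<close>.\<close>

lemma hall_side:
  assumes nu: "\<forall>F\<subseteq>E. (\<Sum>e\<in>F. q e) \<le> \<nu> (\<Union>e\<in>F. H e)" and s: "\<And>t u. {t, u} \<in> E \<Longrightarrow> s t \<noteq> s u"
  shows "hall A (side_vertices s)"
  unfolding hall_def
proof (intro allI impI)
  fix S assume S: "S \<subseteq> side_vertices s"
  define R where "R t = {x \<in> U t. Inl x \<in> S}" for t
  define P where "P = {t \<in> V. s t \<and> R t \<noteq> {}}"
  define Q where "Q = {t \<in> V. \<not> s t \<and> (\<exists>z\<in>W t. Inr z \<in> S)}"
  define Nb where "Nb = {y. Inl y \<in> A\<inverse> `` S \<and> (\<exists>u\<in>V. u \<notin> Q \<and> \<not> s u \<and> y \<in> U u)}"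
  define F where "F = {e \<in> E. \<exists>t u. e = {t, u} \<and> t \<in> P \<and> u \<in> V \<and> u \<notin> Q}"
  have fin: "finite P" "finite Q" using finite_V by (auto simp: P_def Q_def)
  have PV: "P \<subseteq> V" and QV: "Q \<subseteq> V" by (auto simp: P_def Q_def)
  have Nb_sub: "Nb \<subseteq> (\<Union>t\<in>V. U t)" by (auto simp: Nb_def)
  have fNb: "finite Nb" using Nb_sub finite_V finite_U by (meson finite_UN finite_subset)
  have fR: "finite (R t)" "card (R t) \<le> card (U t)" if "t \<in> V" for t
    using finite_U[OF that] by (auto simp: R_def intro: card_mono)
  have fins: "finite (\<Union>t\<in>P. R t)" "finite (\<Union>t\<in>P. W t)" "finite (\<Union>t\<in>Q. W t)" "finite (\<Union>t\<in>Q. U t)"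
    by (rule finite_UN_I[OF fin(1)], rule fR(1), use PV in blast)
      (rule finite_UN_I[OF fin(1)], rule finite_W, use PV in blast,
       rule finite_UN_I[OF fin(2)], rule finite_W, use QV in blast,
       rule finite_UN_I[OF fin(2)], rule finite_U, use QV in blast)
  \<comment> \<open>An upper bound for \<open>S\<close>: its vertices lie in the classes of \<open>P\<close>, its dummies belong to those of \<open>Q\<close>.\<close>
  have "card S \<le> card (Inl ` (\<Union>t\<in>P. R t) \<union> Inr ` (\<Union>t\<in>Q. W t) :: ('v + 'v) set)"
  proof (rule card_mono)
    show "finite (Inl ` (\<Union>t\<in>P. R t) \<union> Inr ` (\<Union>t\<in>Q. W t) :: ('v + 'v) set)"
      using fins by simp
    show "S \<subseteq> Inl ` (\<Union>t\<in>P. R t) \<union> Inr ` (\<Union>t\<in>Q. W t)"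
    proof
      fix v assume v: "v \<in> S"
      with S have "v \<in> side_vertices s" by blast
      then consider x t where "v = Inl x" "t \<in> V" "s t" "x \<in> U t"
        | z t where "v = Inr z" "t \<in> V" "\<not> s t" "z \<in> W t"
        unfolding side_vertices_def by blast
      then show "v \<in> Inl ` (\<Union>t\<in>P. R t) \<union> Inr ` (\<Union>t\<in>Q. W t)"
      proof cases
        case 1
        with v have "t \<in> P" "x \<in> R t" by (auto simp: P_def R_def)
        with 1(1) show ?thesis by blast
      next
        case 2
        with v have "t \<in> Q" by (auto simp: Q_def)
        with 2(1,4) show ?thesis by blast
      qed
    qed
  qed
  also have "\<dots> \<le> card (\<Union>t\<in>P. R t) + card (\<Union>t\<in>Q. W t)"
    using card_Un_le[of "Inl ` (\<Union>t\<in>P. R t) :: ('v + 'v) set" "Inr ` (\<Union>t\<in>Q. W t)"]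
    by (simp add: card_image)
  also have "\<dots> \<le> (\<Sum>t\<in>P. card (R t)) + (\<Sum>t\<in>Q. card (W t))"
    using fin by (intro add_mono card_UN_le)
  finally have S_le: "card S \<le> (\<Sum>t\<in>P. card (R t)) + (\<Sum>t\<in>Q. card (W t))" .

  \<comment> \<open>The neighbours of \<open>S\<close> include all dummies of \<open>P\<close>, all vertices of \<open>Q\<close>, and \<open>Nb\<close>.\<close>
  have disj: "U t \<inter> U u = {}" if "t \<in> V" "u \<in> V" "t \<noteq> u" for t u
    using that same_class by blast
  have "card (\<Union>t\<in>P. W t) = (\<Sum>t\<in>P. card (W t))"
    using fin PV finite_W disj W_sub by (intro card_UN_disjoint) blast+
  moreover have "card ((\<Union>t\<in>Q. U t) \<union> Nb) = (\<Sum>t\<in>Q. card (U t)) + card Nb"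
  proof -
    have "card (\<Union>t\<in>Q. U t) = (\<Sum>t\<in>Q. card (U t))"
      using fin QV finite_U disj by (intro card_UN_disjoint) blast+
    moreover have "(\<Union>t\<in>Q. U t) \<inter> Nb = {}" using QV same_class by (auto simp: Nb_def)
    ultimately show ?thesis
      using fins fNb by (subst card_Un_disjoint) auto
  qed
  moreover have "card (Inr ` (\<Union>t\<in>P. W t) \<union> Inl ` ((\<Union>t\<in>Q. U t) \<union> Nb) :: ('v + 'v) set) =
      card (\<Union>t\<in>P. W t) + card ((\<Union>t\<in>Q. U t) \<union> Nb)"
    using fins fNb by (subst card_Un_disjoint) (auto simp: card_image)
  moreover have "card (Inr ` (\<Union>t\<in>P. W t) \<union> Inl ` ((\<Union>t\<in>Q. U t) \<union> Nb)) \<le> card (A\<inverse> `` S)"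
  proof (rule card_mono)
    show "finite (A\<inverse> `` S)" using finite_arcs by (simp add: finite_Image)
    have "Inr z \<in> A\<inverse> `` S" if "t \<in> P" "z \<in> W t" for t z
    proof -
      from that obtain x where "t \<in> V" "x \<in> U t" "Inl x \<in> S" by (auto simp: P_def R_def)
      with that have "(Inr z, Inl x) \<in> A" unfolding dummy_arcs_def by blast
      with \<open>Inl x \<in> S\<close> show ?thesis by blast
    qed
    moreover have "Inl y \<in> A\<inverse> `` S" if "t \<in> Q" "y \<in> U t" for t y
    proof -
      from that obtain z where "t \<in> V" "z \<in> W t" "Inr z \<in> S" by (auto simp: Q_def)
      with that have "(Inl y, Inr z) \<in> A" unfolding dummy_arcs_def by blast
      with \<open>Inr z \<in> S\<close> show ?thesis by blast
    qed
    ultimately show "Inr ` (\<Union>t\<in>P. W t) \<union> Inl ` ((\<Union>t\<in>Q. U t) \<union> Nb) \<subseteq> A\<inverse> `` S"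
      by (auto simp: Nb_def)
  qed
  ultimately have N_ge: "(\<Sum>t\<in>P. card (W t)) + (\<Sum>t\<in>Q. card (U t)) + card Nb \<le> card (A\<inverse> `` S)"
    by simp

  define C where "C = (\<Union>t\<in>P. U t - R t) \<union> Nb"
  have fC: "finite C" using fin PV finite_U fNb by (auto simp: C_def)
  have FE: "F \<subseteq> E" by (auto simp: F_def)
  have "(\<Sum>e\<in>F. q e) \<le> \<nu> (\<Union>e\<in>F. H e)" using nu FE by blast
  also have "\<dots> \<le> card C"
  proof (rule matching_number_le_cover)
    show "finite (\<Union>e\<in>F. H e)" using FE finite_E finite_H by (meson finite_UN finite_subset subset_iff)
    show "finite C" by (rule fC)
    fix h assume "h \<in> (\<Union>e\<in>F. H e)"
    then obtain e t u where e: "e \<in> E" "h \<in> H e" "e = {t, u}" "t \<in> P" "u \<in> V" "u \<notin> Q"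
      unfolding F_def by blast
    then obtain x y where xy: "h = {x, y}" "x \<in> U t" "y \<in> U u" using bipartite_H by metis
    show "h \<inter> C \<noteq> {}"
    proof (cases "Inl x \<in> S")
      case True
      have "(Inl y, Inl x) \<in> A" using e(1,2) xy(1) unfolding dummy_arcs_def by (auto simp: insert_commute)
      moreover have "\<not> s u" using s[of t u] e by (auto simp: P_def)
      ultimately have "y \<in> Nb" using True e xy by (auto simp: Nb_def)
      with xy show ?thesis by (auto simp: C_def)
    next
      case False
      with e xy show ?thesis by (auto simp: C_def R_def)
    qed
  qed
  also have "\<dots> \<le> card (\<Union>t\<in>P. U t - R t) + card Nb" unfolding C_def by (rule card_Un_le)
  also have "\<dots> \<le> (\<Sum>t\<in>P. card (U t - R t)) + card Nb"
    using fin by (intro add_mono card_UN_le) auto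
  finally have F_le: "(\<Sum>e\<in>F. q e) \<le> (\<Sum>t\<in>P. card (U t - R t)) + card Nb" .

  \<comment> \<open>An edge at \<open>P\<close> either belongs to \<open>F\<close> or has its other end in \<open>Q\<close>.\<close>
  have "(\<Sum>t\<in>P. colour_degree E q t) = (\<Sum>e\<in>E. q e * card (P \<inter> e))"
    using fin finite_E by (simp add: sum_degrees)
  also have "\<dots> \<le> (\<Sum>e\<in>E. (if e \<in> F then q e else 0) + q e * card (Q \<inter> e))"
  proof (rule sum_mono)
    fix e assume e: "e \<in> E"
    then obtain t u where tu: "t \<in> V" "u \<in> V" "t \<noteq> u" "e = {t, u}" using tree_edge by blast
    then have su: "s t \<noteq> s u" using e s by blast
    show "q e * card (P \<inter> e) \<le> (if e \<in> F then q e else 0) + q e * card (Q \<inter> e)"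
    proof (cases "P \<inter> e = {}")
      case False
      with tu obtain a b where ab: "e = {a, b}" "a \<in> P" "b \<in> V" by auto
      have "b \<notin> P" using s[of a b] ab e by (auto simp: P_def)
      with ab have "P \<inter> e = {a}" by auto
      moreover have "e \<in> F \<or> Q \<inter> e = {b}"
      proof (cases "b \<in> Q")
        case True
        moreover have "a \<notin> Q" using ab by (auto simp: P_def Q_def)
        ultimately show ?thesis using ab by auto
      next
        case False
        with ab e show ?thesis by (auto simp: F_def)
      qed
      ultimately show ?thesis by auto
    qed simp
  qed
  also have "\<dots> = (\<Sum>e\<in>F. q e) + (\<Sum>t\<in>Q. colour_degree E q t)"
    using fin finite_E FE
    by (simp add: sum.distrib sum_degrees sum.inter_restrict[symmetric] Int_absorb1)
  finally have deg: "(\<Sum>t\<in>P. colour_degree E q t) \<le> (\<Sum>e\<in>F. q e) + (\<Sum>t\<in>Q. colour_degree E q t)" .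

  have "(\<Sum>t\<in>P. card (U t - R t)) + (\<Sum>t\<in>P. card (R t)) = (\<Sum>t\<in>P. card (U t))"
  proof -
    have "card (U t - R t) + card (R t) = card (U t)" if "t \<in> P" for t
      using that PV finite_U[of t] fR[of t]
      by (metis (no_types, lifting) R_def card_Diff_subset le_add_diff_inverse2 mem_Collect_eq subsetD subsetI)
    then show ?thesis by (simp add: sum.distrib[symmetric])
  qed
  moreover have "(\<Sum>t\<in>T. card (W t)) + (\<Sum>t\<in>T. colour_degree E q t) = (\<Sum>t\<in>T. card (U t))" if "T \<subseteq> V" for T
    using card_W that by (auto simp: sum.distrib[symmetric] intro: sum.cong)
  from this[OF PV] this[OF QV] have "(\<Sum>t\<in>P. card (W t)) + (\<Sum>t\<in>P. colour_degree E q t) = (\<Sum>t\<in>P. card (U t))"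
    "(\<Sum>t\<in>Q. card (W t)) + (\<Sum>t\<in>Q. colour_degree E q t) = (\<Sum>t\<in>Q. card (U t))" .
  ultimately show "card S \<le> card (A\<inverse> `` S)"
    using S_le N_ge F_le deg by linarith
qed

end

context tree_colour_classes
begin

theorem exact_matching_iff_matching_numbers:
  "(\<exists>M. exact_matching E H q M) \<longleftrightarrow> (\<forall>F\<subseteq>E. (\<Sum>e\<in>F. q e) \<le> \<nu> (\<Union>e\<in>F. H e))"
proof
  assume nu: "\<forall>F\<subseteq>E. (\<Sum>e\<in>F. q e) \<le> \<nu> (\<Union>e\<in>F. H e)"
  have "\<forall>t\<in>V. \<exists>B. B \<subseteq> U t \<and> card B + colour_degree E q t = card (U t)"
    using degree_le_card_class[OF nu]
    by (metis diff_le_self le_add_diff_inverse2 obtain_subset_with_card_n)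
  then obtain W where W: "\<And>t. t \<in> V \<Longrightarrow> W t \<subseteq> U t \<and> card (W t) + colour_degree E q t = card (U t)" by metis
  interpret tree_colour_classes_with_dummies V E U H q W
    by unfold_locales (use W in auto)
  from forest_bipartition[OF forest_E] obtain s :: "'t \<Rightarrow> bool"
    where "\<forall>t u. {t, u} \<in> E \<longrightarrow> s t \<noteq> s u" ..
  then have s: "\<And>t u. {t, u} \<in> E \<Longrightarrow> s t \<noteq> s u" by blast
  have fin: "finite (side_vertices s)"
    using finite_V finite_U finite_W unfolding side_vertices_def by auto
  \<comment> \<open>An auction with the vertices of the one side as the only bidders.\<close>
  define A' where "A' = A \<inter> UNIV \<times> side_vertices s"
  have "A'\<inverse> `` S = A\<inverse> `` S" if "S \<subseteq> side_vertices s" for S using that by (auto simp: A'_def)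
  then have "hall A' (side_vertices s)" using hall_side[OF nu s] unfolding hall_def by simp
  then have "saturates A' (side_vertices s)"
    using finite_arcs fin by (intro hall_imp_saturates) (auto simp: A'_def)
  then have "saturates A (side_vertices s)" unfolding saturates_def A'_def by blast
  then show "\<exists>M. exact_matching E H q M" using s by (rule saturates_side_imp_exact_matching)
qed (use exact_matching_imp_matching_number in blast)

end


section \<open>Functions computed in polynomial time\<close>

lemma poly_nat_mono: "x \<le> y \<Longrightarrow> poly p x \<le> poly p y" for x y :: nat and p :: "nat poly"
  by (induction p) (auto intro!: add_mono mult_mono)

lemma nodes_pos [simp]: "0 < nodes d"
  by (cases d) auto

lemma nodes_left: "nodes (left d) \<le> nodes d" and nodes_right: "nodes (right d) \<le> nodes d"
  by (cases d; simp)+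

lemma nodes_eval_le_cost: "nodes (eval a s) \<le> cost a s"
  by (cases a) auto

text \<open>The time of an assignment includes the size of the value, so that a value computed in polynomial
  time has polynomial size.\<close>

lemma nodes_le_time: "exec c s n s' \<Longrightarrow> nodes (s' i) \<le> nodes (s i) + n"
proof (induction rule: exec.induct)
  case (Assign x a s)
  then show ?case using nodes_eval_le_cost[of a s] by auto
qed auto

text \<open>The program \<open>c\<close> replaces the content of variable \<open>k\<close> by its image under \<open>f\<close>. It may overwrite
  the variables above \<open>k\<close>, but relies on nothing about their initial content.\<close>

definition runs :: "com \<Rightarrow> nat \<Rightarrow> (data \<Rightarrow> data) \<Rightarrow> (nat \<Rightarrow> nat) \<Rightarrow> bool" where
  "runs c k f b \<longleftrightarrow> (\<forall>s. \<exists>n s'. exec c s n s' \<and> s' k = f (s k) \<and> (\<forall>i<k. s' i = s i) \<and>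
     n \<le> b (nodes (s k)))"

text \<open>The quantification over \<open>k\<close> lets a program be placed above the variables of its caller, as on a
  stack, so that programs compose without renaming of variables.\<close>

definition polytime :: "(data \<Rightarrow> data) \<Rightarrow> bool" where
  "polytime f \<longleftrightarrow> (\<exists>p :: nat poly. \<forall>k. \<exists>c. runs c k f (poly p))"

lemma polytime_size:
  assumes "polytime f"
  obtains p :: "nat poly" where "\<And>d. nodes (f d) \<le> poly p (nodes d)"
proof -
  from assms obtain p c where c: "runs c 0 f (poly p)" unfolding polytime_def by blast
  have "nodes (f d) \<le> poly ([:0, 1:] + p) (nodes d)" for d
  proof -
    from c[unfolded runs_def, rule_format, of "\<lambda>_. d"] obtain n s'
      where "exec c (\<lambda>_. d) n s'" "s' 0 = f d" "n \<le> poly p (nodes d)" by blast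
    with nodes_le_time[of c "\<lambda>_. d" n s' 0] show ?thesis by simp
  qed
  then show thesis by (rule that)
qed

lemma polytimeI:
  assumes "\<And>k. \<exists>c. \<forall>s. \<exists>n s'. exec c s n s' \<and> s' k = f (s k) \<and> (\<forall>i<k. s' i = s i) \<and>
     n \<le> poly p (nodes (s k))"
  shows "polytime f"
  using assms unfolding polytime_def runs_def by blast

lemma runs_witness:
  "exec c s n s' \<Longrightarrow> s' k = d \<Longrightarrow> \<forall>i<k. s' i = s i \<Longrightarrow> n \<le> b \<Longrightarrow>
    \<exists>n s'. exec c s n s' \<and> s' k = d \<and> (\<forall>i<k. s' i = s i) \<and> n \<le> b"
  by blast

lemma polytime_id: "polytime (\<lambda>d. d)"
proof (rule polytimeI[where p = 1])
  show "\<exists>c. \<forall>s. \<exists>n s'. exec c s n s' \<and> s' k = s k \<and> (\<forall>i<k. s' i = s i) \<and> n \<le> poly 1 (nodes (s k))" for k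
    by (intro exI[of _ Skip] allI) (metis exec.Skip order_refl poly_1)
qed

lemma polytime_assign:
  assumes "\<And>s k. eval (a k) s = f (s k)" and "\<And>s k. cost (a k) s \<le> poly p (nodes (s k))"
  shows "polytime f"
proof (rule polytimeI[where p = "1 + p"])
  fix k
  show "\<exists>c. \<forall>s. \<exists>n s'. exec c s n s' \<and> s' k = f (s k) \<and> (\<forall>i<k. s' i = s i) \<and> n \<le> poly (1 + p) (nodes (s k))"
  proof (intro exI[of _ "Assign k (a k)"] allI)
    fix s
    show "\<exists>n s'. exec (Assign k (a k)) s n s' \<and> s' k = f (s k) \<and> (\<forall>i<k. s' i = s i) \<and> n \<le> poly (1 + p) (nodes (s k))"
      using exec.Assign[of k "a k" s] assms by fastforce
  qed
qed

lemma polytime_Leaf: "polytime (\<lambda>d. Leaf)"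
  by (rule polytime_assign[of "\<lambda>k. Nil_Expr" _ "[:1:]"]) auto

lemma polytime_left_id: "polytime left"
  by (rule polytime_assign[of "\<lambda>k. Hd (Var k)" _ "[:0, 2:]"]) (auto simp: nodes_left)

lemma polytime_right_id: "polytime right"
  by (rule polytime_assign[of "\<lambda>k. Tl (Var k)" _ "[:0, 2:]"]) (auto simp: nodes_right)

lemma polytime_comp:
  assumes "polytime f" and "polytime g"
  shows "polytime (\<lambda>d. f (g d))"
proof -
  from assms(1) obtain p where p: "\<And>k. \<exists>c. runs c k f (poly p)" unfolding polytime_def by blast
  from assms(2) obtain p' where p': "\<And>k. \<exists>c. runs c k g (poly p')" unfolding polytime_def by blast
  obtain r where r: "\<And>d. nodes (g d) \<le> poly r (nodes d)" using polytime_size[OF assms(2)] by blast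
  show ?thesis
  proof (rule polytimeI[where p = "1 + p' + pcompose p r"])
    fix k
    from p p' obtain c c' where c: "runs c k f (poly p)" "runs c' k g (poly p')" by metis
    show "\<exists>c. \<forall>s. \<exists>n s'. exec c s n s' \<and> s' k = f (g (s k)) \<and> (\<forall>i<k. s' i = s i) \<and>
        n \<le> poly (1 + p' + pcompose p r) (nodes (s k))"
    proof (intro exI[of _ "Seq c' c"] allI)
      fix s :: state
      from c(2) obtain n s' where 1: "exec c' s n s'" "s' k = g (s k)" "\<forall>i<k. s' i = s i"
        "n \<le> poly p' (nodes (s k))" unfolding runs_def by blast
      from c(1) obtain m s'' where 2: "exec c s' m s''" "s'' k = f (s' k)" "\<forall>i<k. s'' i = s' i"
        "m \<le> poly p (nodes (s' k))" unfolding runs_def by blast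
      have "m \<le> poly (pcompose p r) (nodes (s k))"
        using 2(4) poly_nat_mono[OF r, of p "s k"] by (simp add: 1(2) poly_pcompose)
      then show "\<exists>n s'. exec (Seq c' c) s n s' \<and> s' k = f (g (s k)) \<and> (\<forall>i<k. s' i = s i) \<and>
          n \<le> poly (1 + p' + pcompose p r) (nodes (s k))"
        using exec.Seq[OF 1(1) 2(1)] 1 2
        by (intro exI[of _ "Suc (n + m)"] exI[of _ s'']) auto
    qed
  qed
qed

text \<open>The program for \<open>f\<close> runs on a copy of the argument in variable \<open>k + 1\<close>, that for \<open>g\<close> on a copy
  in variable \<open>k + 2\<close>.\<close>

lemma polytime_binop:
  assumes "polytime f" and "polytime g"
    and h: "\<And>s i j. eval (a i j) s = h (s i) (s j)"
    and cost: "\<And>s i j. cost (a i j) s \<le> 2 * (nodes (s i) + nodes (s j)) + 4"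
  shows "polytime (\<lambda>d. h (f d) (g d))"
proof -
  from assms(1) obtain p where p: "\<And>k. \<exists>c. runs c k f (poly p)" unfolding polytime_def by blast
  from assms(2) obtain p' where p': "\<And>k. \<exists>c. runs c k g (poly p')" unfolding polytime_def by blast
  obtain r where r: "\<And>d. nodes (f d) \<le> poly r (nodes d)" using polytime_size[OF assms(1)] by blast
  obtain r' where r': "\<And>d. nodes (g d) \<le> poly r' (nodes d)" using polytime_size[OF assms(2)] by blast
  show ?thesis
  proof (rule polytimeI[where p = "[:20, 2:] + p + p' + [:2:] * (r + r')"])
    fix k
    from p p' obtain c c' where c: "runs c (Suc k) f (poly p)" "runs c' (Suc (Suc k)) g (poly p')" by metis
    let ?c = "Seq (Seq (Assign (Suc k) (Var k)) c) (Seq (Seq (Assign (Suc (Suc k)) (Var k)) c')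
      (Assign k (a (Suc k) (Suc (Suc k)))))"
    show "\<exists>c. \<forall>s. \<exists>n s'. exec c s n s' \<and> s' k = h (f (s k)) (g (s k)) \<and> (\<forall>i<k. s' i = s i) \<and>
        n \<le> poly ([:20, 2:] + p + p' + [:2:] * (r + r')) (nodes (s k))"
    proof (intro exI[of _ ?c] allI)
      fix s :: state
      let ?s1 = "s(Suc k := s k)"
      from c(1)[unfolded runs_def, rule_format, of ?s1] obtain n s2
        where 1: "exec c ?s1 n s2" "s2 (Suc k) = f (s k)" "\<forall>i<Suc k. s2 i = ?s1 i" "n \<le> poly p (nodes (s k))" by auto
      let ?s3 = "s2(Suc (Suc k) := s2 k)"
      have s2k: "s2 k = s k" using 1(3) by simp
      from c(2)[unfolded runs_def, rule_format, of ?s3] obtain m s4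
        where 2: "exec c' ?s3 m s4" "s4 (Suc (Suc k)) = g (s k)" "\<forall>i<Suc (Suc k). s4 i = ?s3 i"
          "m \<le> poly p' (nodes (s k))" using s2k by auto
      let ?a = "a (Suc k) (Suc (Suc k))"
      let ?s5 = "s4(k := eval ?a s4)"
      have s4: "s4 (Suc k) = f (s k)" using 2(3) 1(2) by simp
      have e1: "exec (Assign (Suc k) (Var k)) s (Suc (nodes (s k))) ?s1"
        using exec.Assign[of "Suc k" "Var k" s] by simp
      have e2: "exec (Assign (Suc (Suc k)) (Var k)) s2 (Suc (nodes (s k))) ?s3"
        using exec.Assign[of "Suc (Suc k)" "Var k" s2] s2k by simp
      have e3: "exec (Assign k ?a) s4 (Suc (cost ?a s4)) ?s5"
        by (rule exec.Assign)
      note e = exec.Seq[OF exec.Seq[OF e1 1(1)] exec.Seq[OF exec.Seq[OF e2 2(1)] e3]]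
      have "cost ?a s4 \<le> 2 * (poly r (nodes (s k)) + poly r' (nodes (s k))) + 4"
        using cost[of "Suc k" "Suc (Suc k)" s4] r[of "s k"] r'[of "s k"] s4 2(2) by simp
      moreover have "\<forall>i<k. ?s5 i = s i" using 1(3) 2(3) by auto
      moreover have "?s5 k = h (f (s k)) (g (s k))" using h s4 2(2) by simp
      ultimately show "\<exists>n s'. exec ?c s n s' \<and> s' k = h (f (s k)) (g (s k)) \<and> (\<forall>i<k. s' i = s i) \<and>
          n \<le> poly ([:20, 2:] + p + p' + [:2:] * (r + r')) (nodes (s k))"
        by (intro runs_witness[OF e]) (use 1(4) 2(4) in auto)
    qed
  qed
qed

lemma polytime_Node: "polytime f \<Longrightarrow> polytime g \<Longrightarrow> polytime (\<lambda>d. Node (f d) (g d))"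
  by (rule polytime_binop[where a = "\<lambda>i j. Cons_Expr (Var i) (Var j)"]) auto

lemma polytime_eq: "polytime f \<Longrightarrow> polytime g \<Longrightarrow> polytime (\<lambda>d. enc_bool (f d = g d))"
  by (rule polytime_binop[where a = "\<lambda>i j. Eq (Var i) (Var j)"]) (auto simp: enc_bool_def)

lemma polytime_if_Leaf:
  assumes "polytime b" and "polytime f" and "polytime g"
  shows "polytime (\<lambda>d. if b d = Leaf then g d else f d)"
proof -
  from assms(1) obtain q where q: "\<And>k. \<exists>c. runs c k b (poly q)" unfolding polytime_def by blast
  from assms(2) obtain p where p: "\<And>k. \<exists>c. runs c k f (poly p)" unfolding polytime_def by blast
  from assms(3) obtain p' where p': "\<And>k. \<exists>c. runs c k g (poly p')" unfolding polytime_def by blast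
  obtain r where r: "\<And>d. nodes (b d) \<le> poly r (nodes d)" using polytime_size[OF assms(1)] by blast
  show ?thesis
  proof (rule polytimeI[where p = "[:20, 2:] + q + r + p + p'"])
    fix k
    from q p p' obtain cb c c' where c: "runs cb (Suc k) b (poly q)" "runs c k f (poly p)" "runs c' k g (poly p')"
      by metis
    let ?c = "Seq (Seq (Assign (Suc k) (Var k)) cb) (If (Var (Suc k)) c c')"
    show "\<exists>c. \<forall>s. \<exists>n s'. exec c s n s' \<and> s' k = (if b (s k) = Leaf then g (s k) else f (s k)) \<and>
        (\<forall>i<k. s' i = s i) \<and> n \<le> poly ([:20, 2:] + q + r + p + p') (nodes (s k))"
    proof (intro exI[of _ ?c] allI)
      fix s :: state
      let ?s1 = "s(Suc k := s k)"
      from c(1)[unfolded runs_def, rule_format, of ?s1] obtain n s2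
        where 1: "exec cb ?s1 n s2" "s2 (Suc k) = b (s k)" "\<forall>i<Suc k. s2 i = ?s1 i" "n \<le> poly q (nodes (s k))" by auto
      have s2k: "s2 k = s k" using 1(3) by simp
      have e1: "exec (Assign (Suc k) (Var k)) s (Suc (nodes (s k))) ?s1"
        using exec.Assign[of "Suc k" "Var k" s] by simp
      obtain m s3 where 2: "exec (If (Var (Suc k)) c c') s2 (Suc (nodes (b (s k)) + m)) s3"
        "s3 k = (if b (s k) = Leaf then g (s k) else f (s k))" "\<forall>i<k. s3 i = s2 i"
        "m \<le> poly p (nodes (s k)) + poly p' (nodes (s k))"
      proof (cases "b (s k) = Leaf")
        case True
        from c(3)[unfolded runs_def, rule_format, of s2] obtain m s3
          where 2: "exec c' s2 m s3" "s3 k = g (s k)" "\<forall>i<k. s3 i = s2 i" "m \<le> poly p' (nodes (s k))"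
          using s2k by auto
        have "exec (If (Var (Suc k)) c c') s2 (Suc (nodes (b (s k)) + m)) s3"
          using exec.If_False[of "Var (Suc k)" s2 c' m s3 c] 2(1) True 1(2) by simp
        with 2 True that show thesis by simp
      next
        case False
        from c(2)[unfolded runs_def, rule_format, of s2] obtain m s3
          where 2: "exec c s2 m s3" "s3 k = f (s k)" "\<forall>i<k. s3 i = s2 i" "m \<le> poly p (nodes (s k))"
          using s2k by auto
        have "exec (If (Var (Suc k)) c c') s2 (Suc (nodes (b (s k)) + m)) s3"
          using exec.If_True[of "Var (Suc k)" s2 c m s3 c'] 2(1) False 1(2) by simp
        with 2 False that show thesis by simp
      qed
      note e = exec.Seq[OF exec.Seq[OF e1 1(1)] 2(1)]
      have "\<forall>i<k. s3 i = s i" using 1(3) 2(3) by auto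
      then show "\<exists>n s'. exec ?c s n s' \<and> s' k = (if b (s k) = Leaf then g (s k) else f (s k)) \<and>
          (\<forall>i<k. s' i = s i) \<and> n \<le> poly ([:20, 2:] + q + r + p + p') (nodes (s k))"
        by (intro runs_witness[OF e]) (use 1(4) 2(2,4) r[of "s k"] in auto)
    qed
  qed
qed

lemma polytime_left: "polytime f \<Longrightarrow> polytime (\<lambda>d. left (f d))"
  and polytime_right: "polytime f \<Longrightarrow> polytime (\<lambda>d. right (f d))"
  by (rule polytime_comp[OF polytime_left_id] polytime_comp[OF polytime_right_id]; assumption)+

lemma polytime_if_eq:
  assumes "polytime a" "polytime b" "polytime f" "polytime g"
  shows "polytime (\<lambda>d. if a d = b d then f d else g d)"
proof -
  have "(\<lambda>d. if a d = b d then f d else g d) = (\<lambda>d. if enc_bool (a d = b d) = Leaf then g d else f d)"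
    by (auto simp: enc_bool_def)
  then show ?thesis using polytime_if_Leaf[OF polytime_eq[OF assms(1,2)] assms(3,4)] by simp
qed

lemma polytime_comp2:
  assumes "polytime (\<lambda>e. f (left e) (right e))" and "polytime a" and "polytime b"
  shows "polytime (\<lambda>d. f (a d) (b d))"
  using polytime_comp[OF assms(1) polytime_Node[OF assms(2,3)]] by simp

lemma polytime_comp3:
  assumes "polytime (\<lambda>e. f (left e) (left (right e)) (right (right e)))"
    and "polytime a" and "polytime b" and "polytime c"
  shows "polytime (\<lambda>d. f (a d) (b d) (c d))"
  using polytime_comp[OF assms(1) polytime_Node[OF assms(2) polytime_Node[OF assms(3,4)]]] by simp


section \<open>Iteration over lists\<close>

text \<open>Every tree is a list of trees, the entries being the left subtrees along its right spine.\<close>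

primrec elems :: "data \<Rightarrow> data list" where
  "elems Leaf = []"
| "elems (Node a b) = a # elems b"

lemma elems_inj: "elems d = elems d' \<longleftrightarrow> d = d'"
proof (induction d arbitrary: d')
  case Leaf
  then show ?case by (cases d') auto
next
  case (Node a b)
  then show ?case by (cases d') auto
qed

lemma elems_eq_Nil [simp]: "elems d = [] \<longleftrightarrow> d = Leaf"
  by (cases d) auto

lemma nodes_elems: "nodes d = Suc (\<Sum>x\<leftarrow>elems d. Suc (nodes x))"
  by (induction d) auto

lemma length_elems: "length (elems d) \<le> nodes d"
  by (induction d) auto

lemma nodes_elem: "x \<in> set (elems d) \<Longrightarrow> nodes x \<le> nodes d"
  by (induction d) auto

text \<open>The loop: variable \<open>k\<close> holds the parameter, \<open>k + 1\<close> the rest of the list, and \<open>k + 2\<close> the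
  accumulator. A round evaluates a few expressions, whose values are composed of those of these
  variables; the factor 20 is a generous bound for their number.\<close>

lemma exec_fold_loop:
  fixes F :: "data \<Rightarrow> data \<Rightarrow> data \<Rightarrow> data"
  assumes c: "runs c (k + 3) (\<lambda>e. F (left e) (left (right e)) (right (right e))) (poly p)"
    and "nodes (s k) \<le> D" "nodes (s (k + 1)) \<le> L"
    and "\<And>i. nodes (fold (F (s k)) (take i (elems (s (k + 1)))) (s (k + 2))) \<le> B"
  shows "\<exists>n s'. exec (While (Var (k + 1))
      (Seq (Seq (Assign (k + 3) (Cons_Expr (Var k) (Cons_Expr (Hd (Var (k + 1))) (Var (k + 2))))) c)
        (Seq (Assign (k + 2) (Var (k + 3))) (Assign (k + 1) (Tl (Var (k + 1))))))) s n s' \<and>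
    s' (k + 2) = fold (F (s k)) (elems (s (k + 1))) (s (k + 2)) \<and> (\<forall>i\<le>k. s' i = s i) \<and>
    n \<le> Suc (length (elems (s (k + 1)))) * (20 * (D + L + B + 1) + poly p (D + L + B + 2))"
    (is "\<exists>n s'. exec (While _ ?body) _ _ _ \<and> _ \<and> _ \<and> n \<le> _ * ?K")
  using assms(2-)
proof (induction "elems (s (k + 1))" arbitrary: s)
  case Nil
  then have L: "s (k + 1) = Leaf" by (metis elems_eq_Nil)
  have "exec (While (Var (k + 1)) ?body) s 2 s"
    using exec.While_False[of "Var (k + 1)" s ?body] L by (simp add: numeral_2_eq_2)
  then show ?case using L by (intro exI[of _ 2] exI[of _ s]) auto
next
  case (Cons x xs)
  then obtain l' where l: "s (k + 1) = Node x l'" "xs = elems l'"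
    by (cases "s (k + 1)") auto
  let ?cons = "Cons_Expr (Var k) (Cons_Expr (Hd (Var (k + 1))) (Var (k + 2)))"
  have acc: "nodes (s (k + 2)) \<le> B" using Cons.prems(3)[of 0] by simp
  have x: "Suc (Suc (nodes x)) \<le> L" "nodes l' \<le> L" using Cons.prems(2) l nodes_pos[of l'] by (auto simp del: nodes_pos)
  let ?e = "Node (s k) (Node x (s (k + 2)))"
  let ?s1 = "s(k + 3 := ?e)"
  have e1: "exec (Assign (k + 3) ?cons) s (Suc (cost ?cons s)) ?s1"
    using exec.Assign[of "k + 3" ?cons s] l by simp
  have c1: "cost ?cons s \<le> 2 * D + 4 * L + 3 * B + 3"
    using Cons.prems(1,2) acc l x by simp
  let ?acc = "F (s k) x (s (k + 2))"
  from c[unfolded runs_def, rule_format, of ?s1] obtain m s2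
    where 2: "exec c ?s1 m s2" "s2 (k + 3) = ?acc" "\<forall>i<k + 3. s2 i = ?s1 i" "m \<le> poly p (nodes ?e)"
    by auto
  have "nodes ?e \<le> D + L + B + 2" using Cons.prems(1) acc x by simp
  then have m: "m \<le> poly p (D + L + B + 2)" using 2(4) poly_nat_mono order_trans by blast
  have s2: "s2 k = s k" "s2 (k + 1) = s (k + 1)" using 2(3) by simp_all
  have acc': "nodes ?acc \<le> B"
    using Cons.prems(3)[of 1] l by simp
  let ?s3 = "s2(k + 2 := ?acc)"
  have e3: "exec (Assign (k + 2) (Var (k + 3))) s2 (Suc (nodes ?acc)) ?s3"
    using exec.Assign[of "k + 2" "Var (k + 3)" s2] 2(2) by simp
  let ?s4 = "?s3(k + 1 := l')"
  have e4: "exec (Assign (k + 1) (Tl (Var (k + 1)))) ?s3 (Suc (nodes (s (k + 1)) + nodes l')) ?s4"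
    using exec.Assign[of "k + 1" "Tl (Var (k + 1))" ?s3] s2 l by simp
  note body = exec.Seq[OF exec.Seq[OF e1 2(1)] exec.Seq[OF e3 e4]]
  have s4: "?s4 k = s k" "?s4 (k + 1) = l'" "?s4 (k + 2) = ?acc" using s2 by simp_all
  have "\<exists>n s'. exec (While (Var (k + 1)) ?body) ?s4 n s' \<and>
      s' (k + 2) = fold (F (?s4 k)) (elems (?s4 (k + 1))) (?s4 (k + 2)) \<and> (\<forall>i\<le>k. s' i = ?s4 i) \<and>
      n \<le> Suc (length (elems (?s4 (k + 1)))) * ?K"
  proof (rule Cons.hyps(1))
    show "xs = elems (?s4 (k + 1))" using l s4 by simp
    show "nodes (?s4 k) \<le> D" "nodes (?s4 (k + 1)) \<le> L" using Cons.prems(1) x s4 by simp_all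
    show "nodes (fold (F (?s4 k)) (take i (elems (?s4 (k + 1)))) (?s4 (k + 2))) \<le> B" for i
      using Cons.prems(3)[of "Suc i"] l unfolding s4 by simp
  qed
  then obtain n s' where 5: "exec (While (Var (k + 1)) ?body) ?s4 n s'"
      "s' (k + 2) = fold (F (s k)) (elems l') ?acc" "\<forall>i\<le>k. s' i = ?s4 i"
      "n \<le> Suc (length (elems l')) * ?K"
    unfolding s4 by blast
  have ne: "eval (Var (k + 1)) s \<noteq> Leaf" using l by simp
  note loop = exec.While_True[OF ne body 5(1)]
  have "\<forall>i\<le>k. s' i = s i" using 5(3) 2(3) by auto
  moreover have "s' (k + 2) = fold (F (s k)) (elems (s (k + 1))) (s (k + 2))"
    using 5(2) l by simp
  moreover have "Suc (cost (Var (k + 1)) s +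
      Suc (Suc (Suc (cost ?cons s) + m) + Suc (Suc (nodes ?acc) + Suc (nodes (s (k + 1)) + nodes l'))) + n)
      \<le> Suc (length (elems (s (k + 1)))) * ?K"
  proof -
    have "Suc (cost (Var (k + 1)) s +
      Suc (Suc (Suc (cost ?cons s) + m) + Suc (Suc (nodes ?acc) + Suc (nodes (s (k + 1)) + nodes l')))) \<le> ?K"
      using c1 m acc' x Cons.prems(2) by simp
    moreover have "Suc (length (elems (s (k + 1)))) * ?K = ?K + Suc (length (elems l')) * ?K"
      using l by simp
    ultimately show ?thesis using 5(4) by linarith
  qed
  ultimately show ?case using loop by blast
qed

text \<open>Polynomially many steps can square the size each time, hence the assumption that all intermediate
  values are polynomially bounded.\<close>

lemma polytime_bounded_fold:
  assumes "polytime l" and "polytime a"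
    and "polytime (\<lambda>e. F (left e) (left (right e)) (right (right e)))"
    and bound: "\<And>d i. nodes (fold (F d) (take i (elems (l d))) (a d)) \<le> poly b (nodes d)"
  shows "polytime (\<lambda>d. fold (F d) (elems (l d)) (a d))"
proof -
  from assms(1) obtain p where p: "\<And>k. \<exists>c. runs c k l (poly p)" unfolding polytime_def by blast
  from assms(2) obtain q where q: "\<And>k. \<exists>c. runs c k a (poly q)" unfolding polytime_def by blast
  from assms(3) obtain g where g: "\<And>k. \<exists>c. runs c k (\<lambda>e. F (left e) (left (right e)) (right (right e))) (poly g)"
    unfolding polytime_def by blast
  obtain r where r: "\<And>d. nodes (l d) \<le> poly r (nodes d)" using polytime_size[OF assms(1)] by blast
  let ?z = "[:0, 1:] + r + b"
  let ?P = "[:20, 2:] + p + q + b + ([:1:] + r) * ([:20:] * (?z + [:1:]) + pcompose g (?z + [:2:]))"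
  show ?thesis
  proof (rule polytimeI[where p = ?P])
    fix k
    obtain cl where cl: "runs cl (k + 1) l (poly p)" using p by blast
    obtain ca where ca: "runs ca (k + 2) a (poly q)" using q by blast
    obtain cF where cF: "runs cF (k + 3) (\<lambda>e. F (left e) (left (right e)) (right (right e))) (poly g)" using g by blast
    let ?loop = "While (Var (k + 1))
      (Seq (Seq (Assign (k + 3) (Cons_Expr (Var k) (Cons_Expr (Hd (Var (k + 1))) (Var (k + 2))))) cF)
        (Seq (Assign (k + 2) (Var (k + 3))) (Assign (k + 1) (Tl (Var (k + 1))))))"
    let ?c = "Seq (Seq (Seq (Assign (k + 1) (Var k)) cl) (Seq (Assign (k + 2) (Var k)) ca))
      (Seq ?loop (Assign k (Var (k + 2))))"
    show "\<exists>c. \<forall>s. \<exists>n s'. exec c s n s' \<and> s' k = fold (F (s k)) (elems (l (s k))) (a (s k)) \<and>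
        (\<forall>i<k. s' i = s i) \<and> n \<le> poly ?P (nodes (s k))"
    proof (intro exI[of _ ?c] allI)
      fix s :: state
      let ?d = "s k" let ?n = "nodes (s k)"
      let ?s1 = "s(k + 1 := s k)"
      from cl[unfolded runs_def, rule_format, of ?s1] obtain n s2
        where 1: "exec cl ?s1 n s2" "s2 (k + 1) = l ?d" "\<forall>i<k + 1. s2 i = ?s1 i" "n \<le> poly p ?n" by auto
      let ?s3 = "s2(k + 2 := s2 k)"
      have s2k: "s2 k = s k" using 1(3) by simp
      from ca[unfolded runs_def, rule_format, of ?s3] obtain m s4
        where 2: "exec ca ?s3 m s4" "s4 (k + 2) = a ?d" "\<forall>i<k + 2. s4 i = ?s3 i" "m \<le> poly q ?n"
        using s2k by auto
      have s4: "s4 k = ?d" "s4 (k + 1) = l ?d" using 2(3) 1(2) s2k by simp_all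
      have e1: "exec (Assign (k + 1) (Var k)) s (Suc ?n) ?s1"
        using exec.Assign[of "k + 1" "Var k" s] by simp
      have e2: "exec (Assign (k + 2) (Var k)) s2 (Suc ?n) ?s3"
        using exec.Assign[of "k + 2" "Var k" s2] s2k by simp
      let ?L = "poly r ?n" let ?B = "poly b ?n"
      from exec_fold_loop[OF cF, of s4 ?n ?L ?B] r[of ?d] bound[of ?d] obtain j s5
        where 3: "exec ?loop s4 j s5" "s5 (k + 2) = fold (F ?d) (elems (l ?d)) (a ?d)" "\<forall>i\<le>k. s5 i = s4 i"
          "j \<le> Suc (length (elems (l ?d))) * (20 * (?n + ?L + ?B + 1) + poly g (?n + ?L + ?B + 2))"
        unfolding s4 2(2) by blast
      let ?s6 = "s5(k := s5 (k + 2))"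
      have e3: "exec (Assign k (Var (k + 2))) s5 (Suc (nodes (s5 (k + 2)))) ?s6"
        using exec.Assign[of k "Var (k + 2)" s5] by simp
      have "nodes (s5 (k + 2)) \<le> ?B"
        using bound[of ?d "length (elems (l ?d))"] 3(2) by simp
      moreover have "j \<le> (1 + ?L) * (20 * (?n + ?L + ?B + 1) + poly g (?n + ?L + ?B + 2))"
      proof (rule order_trans[OF 3(4)], rule mult_right_mono)
        show "Suc (length (elems (l ?d))) \<le> 1 + ?L"
          using length_elems[of "l ?d"] r[of ?d] by simp
      qed simp
      moreover have "\<forall>i<k. ?s6 i = s i" using 1(3) 2(3) 3(3) by auto
      moreover note e = exec.Seq[OF exec.Seq[OF exec.Seq[OF e1 1(1)] exec.Seq[OF e2 2(1)]] exec.Seq[OF 3(1) e3]]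
      moreover have "poly ?P ?n = 20 + 2 * ?n + poly p ?n + poly q ?n + ?B +
          (1 + ?L) * (20 * (?n + ?L + ?B + 1) + poly g (?n + ?L + ?B + 2))"
        by (simp add: poly_pcompose mult.commute)
      ultimately show "\<exists>n s'. exec ?c s n s' \<and> s' k = fold (F (s k)) (elems (l (s k))) (a (s k)) \<and>
          (\<forall>i<k. s' i = s i) \<and> n \<le> poly ?P (nodes (s k))"
        by (intro runs_witness[OF e]) (use 1(4) 2(4) 3(2) in simp_all)
    qed
  qed
qed

text \<open>A step that enlarges the accumulator by at most an amount independent of it keeps the
  accumulator polynomially bounded.\<close>

lemma polytime_fold:
  assumes "polytime l" and "polytime a"
    and "polytime (\<lambda>e. F (left e) (left (right e)) (right (right e)))"
    and growth: "\<And>d x acc. nodes (F d x acc) \<le> nodes acc + poly g (nodes d + nodes x)"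
  shows "polytime (\<lambda>d. fold (F d) (elems (l d)) (a d))"
proof -
  obtain r where r: "\<And>d. nodes (l d) \<le> poly r (nodes d)" using polytime_size[OF assms(1)] by blast
  obtain q where q: "\<And>d. nodes (a d) \<le> poly q (nodes d)" using polytime_size[OF assms(2)] by blast
  show ?thesis
  proof (rule polytime_bounded_fold[where b = "q + r * pcompose g ([:0, 1:] + r)"])
    fix d i
    have fold_le: "nodes (fold (F d) xs acc) \<le> nodes acc + length xs * poly g (nodes d + nodes (l d))"
      if "set xs \<subseteq> set (elems (l d))" for xs acc
      using that
    proof (induction xs arbitrary: acc)
      case (Cons x xs)
      have "nodes (F d x acc) \<le> nodes acc + poly g (nodes d + nodes (l d))"
        using growth[of d x acc] nodes_elem[of x "l d"] Cons.prems
          poly_nat_mono[of "nodes d + nodes x" "nodes d + nodes (l d)" g] by simp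
      moreover have "nodes (fold (F d) xs (F d x acc)) \<le>
          nodes (F d x acc) + length xs * poly g (nodes d + nodes (l d))"
        using Cons by simp
      ultimately show ?case by simp
    qed simp
    have "nodes (fold (F d) (take i (elems (l d))) (a d)) \<le>
        nodes (a d) + length (take i (elems (l d))) * poly g (nodes d + nodes (l d))"
      by (rule fold_le) (rule set_take_subset)
    also have "\<dots> \<le> poly q (nodes d) + poly r (nodes d) * poly g (nodes d + poly r (nodes d))"
    proof (intro add_mono mult_mono q poly_nat_mono)
      show "length (take i (elems (l d))) \<le> poly r (nodes d)"
        using length_elems[of "l d"] r[of d] by simp
    qed (use r in auto)
    finally show "nodes (fold (F d) (take i (elems (l d))) (a d)) \<le>
        poly (q + r * pcompose g ([:0, 1:] + r)) (nodes d)"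
      by (simp add: poly_pcompose)
  qed (use assms in auto)
qed

abbreviation single :: "data \<Rightarrow> data" where
  "single x \<equiv> Node x Leaf"

text \<open>The functions below read every tree as a list, so that their time bounds hold for all inputs,
  whether or not these encode an instance. Where the order of a list is immaterial,
  the reversal caused by an accumulator is left in place.\<close>

definition append_rev :: "data \<Rightarrow> data \<Rightarrow> data" where
  "append_rev l m = fold Node (elems l) m"

definition collect :: "(data \<Rightarrow> data) \<Rightarrow> data \<Rightarrow> data" where
  "collect g l = fold (\<lambda>x. append_rev (g x)) (elems l) Leaf"

definition drop_elems :: "data \<Rightarrow> data \<Rightarrow> data" where
  "drop_elems l m = fold (\<lambda>_. right) (elems l) m"

lemma elems_append_rev: "elems (append_rev l m) = rev (elems l) @ elems m"
proof -
  have "elems (fold Node xs m) = rev xs @ elems m" for xs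
    by (induction xs arbitrary: m) auto
  then show ?thesis by (simp add: append_rev_def)
qed

lemma nodes_append_rev: "nodes (append_rev l m) \<le> nodes l + nodes m"
  using nodes_elems[of "append_rev l m"] nodes_elems[of l] nodes_elems[of m]
  by (simp add: elems_append_rev rev_map[symmetric] sum_list_rev)

lemma elems_collect_aux:
  "set (elems (fold (\<lambda>x. append_rev (g x)) xs m)) = (\<Union>x\<in>set xs. set (elems (g x))) \<union> set (elems m)"
  "length (elems (fold (\<lambda>x. append_rev (g x)) xs m)) = (\<Sum>x\<leftarrow>xs. length (elems (g x))) + length (elems m)"
  by (induction xs arbitrary: m) (auto simp: elems_append_rev)

lemma set_collect: "set (elems (collect g l)) = (\<Union>x\<in>set (elems l). set (elems (g x)))"
  and length_collect: "length (elems (collect g l)) = (\<Sum>x\<leftarrow>elems l. length (elems (g x)))"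
  by (simp_all add: collect_def elems_collect_aux)

lemma collect_eq_Leaf: "collect g l = Leaf \<longleftrightarrow> (\<forall>x\<in>set (elems l). g x = Leaf)"
  using set_collect[of g l] by (metis (no_types, lifting) SUP_bot_conv(2) elems_eq_Nil set_empty)

lemma elems_drop_elems: "elems (drop_elems l m) = drop (length (elems l)) (elems m)"
proof -
  have "elems (right m) = tl (elems m)" for m by (cases m) auto
  then have "elems (fold (\<lambda>_. right) xs m) = drop (length xs) (elems m)" for xs
    by (induction xs arbitrary: m) (auto simp: drop_Suc)
  then show ?thesis by (simp add: drop_elems_def)
qed

lemma drop_elems_eq_Leaf: "drop_elems l m = Leaf \<longleftrightarrow> length (elems m) \<le> length (elems l)"
  using elems_drop_elems[of l m] by (metis drop_eq_Nil elems_eq_Nil)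

lemmas polytime_basic = polytime_id polytime_Leaf polytime_Node polytime_left polytime_right polytime_if_eq

lemma polytime_append_rev:
  assumes "polytime l" and "polytime m"
  shows "polytime (\<lambda>d. append_rev (l d) (m d))"
  unfolding append_rev_def
  by (rule polytime_fold[where g = "[:1, 1:]"]) (intro assms polytime_basic | simp)+

lemma polytime_drop_elems:
  assumes "polytime l" and "polytime m"
  shows "polytime (\<lambda>d. drop_elems (l d) (m d))"
  unfolding drop_elems_def
  by (rule polytime_fold[where g = 0]) (intro assms polytime_basic | simp add: nodes_right)+

lemma polytime_collect:
  assumes "polytime (\<lambda>e. g (left e) (right e))" and "polytime l"
  shows "polytime (\<lambda>d. collect (g d) (l d))"
proof -
  obtain r where r: "\<And>e. nodes (g (left e) (right e)) \<le> poly r (nodes e)"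
    using polytime_size[OF assms(1)] by blast
  show ?thesis
    unfolding collect_def
  proof (rule polytime_fold[where g = "pcompose r [:1, 1:]"])
    show "polytime (\<lambda>e. append_rev (g (left e) (left (right e))) (right (right e)))"
      by (intro polytime_append_rev polytime_comp2[OF assms(1)] polytime_basic)
    show "nodes (append_rev (g d x) acc) \<le> nodes acc + poly (pcompose r [:1, 1:]) (nodes d + nodes x)"
      for d x acc
      using nodes_append_rev[of "g d x" acc] r[of "Node d x"] by (simp add: poly_pcompose)
  qed (intro assms polytime_basic)+
qed

lemmas polytime_intros = polytime_basic polytime_append_rev polytime_drop_elems polytime_collect


section \<open>The auction as a program\<close>

abbreviation as_pair :: "data \<Rightarrow> data \<times> data" where
  "as_pair d \<equiv> (left d, right d)"

abbreviation pairs :: "data \<Rightarrow> (data \<times> data) list" where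
  "pairs d \<equiv> map as_pair (elems d)"

lemma in_pairs: "(y, x) \<in> set (pairs d) \<longleftrightarrow> (\<exists>b\<in>set (elems d). left b = y \<and> right b = x)"
  by auto

text \<open>Of the bids on an item, the first one in the list is kept, being the latest.\<close>

definition winners :: "data \<Rightarrow> data" where
  "winners W = fold (\<lambda>b acc.
     if collect (\<lambda>b'. if left b' = left b then single Leaf else Leaf) acc = Leaf
     then Node b acc else acc) (elems W) Leaf"

definition won :: "data \<Rightarrow> data \<Rightarrow> data" where
  "won x W = collect (\<lambda>b. if right b = x then single Leaf else Leaf) (winners W)"

definition unary_price :: "data \<Rightarrow> data \<Rightarrow> data" where
  "unary_price y W = collect (\<lambda>b. if left b = y then single Leaf else Leaf) W"

text \<open>Dropping as many entries as the other price has leaves something exactly if that price is lower.\<close>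

definition cheaper :: "data \<Rightarrow> data \<Rightarrow> data \<Rightarrow> data" where
  "cheaper A a W = collect (\<lambda>a'. if right a' = right a
     then drop_elems (unary_price (left a') W) (unary_price (left a) W) else Leaf) A"

definition candidates :: "data \<Rightarrow> data \<Rightarrow> data" where
  "candidates A W = collect (\<lambda>a. if won (right a) W = Leaf
     then (if cheaper A a W = Leaf then single a else Leaf) else Leaf) A"

definition bid_step :: "data \<Rightarrow> data \<Rightarrow> data" where
  "bid_step A W = (if candidates A W = Leaf then W else Node (left (candidates A W)) W)"

definition bid_round :: "data \<Rightarrow> data \<Rightarrow> data" where
  "bid_round A W = fold (\<lambda>_. bid_step A) (elems (Node Leaf A)) W"

text \<open>The number of steps is the square of a number greater than the number of items. If all of them were
  bids, there would be more bids than Hall's condition permits; so, if the condition holds, the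
  bidding has come to an end before.\<close>

definition run_auction :: "data \<Rightarrow> data" where
  "run_auction A = fold (\<lambda>_. bid_round A) (elems (Node Leaf A)) Leaf"

lemma winners_iff:
  "(y, x) \<in> set (pairs (winners W)) \<longleftrightarrow> map_of (pairs W) y = Some x"
proof -
  let ?F = "\<lambda>b acc. if collect (\<lambda>b'. if left b' = left b then single Leaf else Leaf) acc = Leaf
     then Node b acc else acc"
  have "(y, x) \<in> set (pairs (fold ?F bs Leaf)) \<longleftrightarrow> map_of (map as_pair bs) y = Some x" for bs
  proof (induction bs arbitrary: x y rule: rev_induct)
    case (snoc b bs)
    have "collect (\<lambda>b'. if left b' = left b then single Leaf else Leaf) (fold ?F bs Leaf) = Leaf \<longleftrightarrow>
        (\<forall>x. (left b, x) \<notin> set (pairs (fold ?F bs Leaf)))"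
      unfolding collect_eq_Leaf in_pairs by auto
    also have "\<dots> \<longleftrightarrow> map_of (map as_pair bs) (left b) = None"
      using snoc.IH by auto
    finally show ?case
      using snoc.IH[of y x] by (auto simp: map_add_def split: option.splits)
  qed simp
  then show ?thesis by (simp add: winners_def)
qed

lemma won_eq_Leaf: "won x W = Leaf \<longleftrightarrow> free (pairs W) x"
proof -
  have "won x W = Leaf \<longleftrightarrow> (\<forall>y. (y, x) \<notin> set (pairs (winners W)))"
    unfolding won_def collect_eq_Leaf by auto
  then show ?thesis unfolding winners_iff by (auto simp: ran_def)
qed

lemma length_unary_price: "length (elems (unary_price y W)) = price (pairs W) y"
proof -
  have "(\<Sum>b\<leftarrow>bs. length (elems (if left b = y then single Leaf else Leaf))) = price (map as_pair bs) y" for bs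
    by (induction bs) auto
  then show ?thesis by (simp add: unary_price_def length_collect)
qed

lemma set_candidates:
  "set (elems (candidates A W)) =
     {a \<in> set (elems A). biddable (set (pairs A)) (pairs W) (as_pair a)}"
proof -
  have "cheaper A a W = Leaf \<longleftrightarrow>
      (\<forall>y. (y, right a) \<in> set (pairs A) \<longrightarrow> price (pairs W) (left a) \<le> price (pairs W) y)" for a
    unfolding cheaper_def collect_eq_Leaf in_pairs
    by (auto simp: drop_elems_eq_Leaf length_unary_price)
  then show ?thesis
    unfolding candidates_def set_collect
    by (auto simp: won_eq_Leaf biddable_def split: if_splits)
qed

lemma bid_step_cases:
  obtains "\<nexists>b. biddable (set (pairs A)) (pairs W) b" "bid_step A W = W"
  | a where "a \<in> set (elems A)" "biddable (set (pairs A)) (pairs W) (as_pair a)" "bid_step A W = Node a W"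
proof (cases "candidates A W")
  case Leaf
  then have "\<nexists>b. biddable (set (pairs A)) (pairs W) b"
    using set_candidates[of A W] by (fastforce simp: biddable_def)
  with Leaf show thesis using that(1) by (simp add: bid_step_def)
next
  case (Node a c)
  then have "a \<in> set (elems (candidates A W))" by simp
  then show thesis
    unfolding set_candidates by (intro that(2)[of a]) (simp_all add: bid_step_def Node)
qed

lemma iterated_bids:
  "auction (set (pairs A)) (pairs ((bid_step A ^^ n) Leaf)) \<and>
   ((\<nexists>b. biddable (set (pairs A)) (pairs ((bid_step A ^^ n) Leaf)) b) \<or>
    length (pairs ((bid_step A ^^ n) Leaf)) = n)"
proof (induction n)
  case 0
  then show ?case by (simp add: auction.start)
next
  case (Suc n)
  show ?case
    by (rule bid_step_cases[of A "(bid_step A ^^ n) Leaf"]) (use Suc in \<open>auto intro: auction.bid\<close>)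
qed

lemma fold_const: "fold (\<lambda>_. f) xs = f ^^ length xs"
  by (induction xs) (simp_all add: funpow_Suc_right del: funpow.simps)

lemma run_auction_eq:
  "run_auction A = (bid_step A ^^ (Suc (length (elems A)) * Suc (length (elems A)))) Leaf"
proof -
  have "bid_round A = bid_step A ^^ Suc (length (elems A))"
    by (rule ext) (simp add: bid_round_def fold_const del: fold.simps funpow.simps)
  then show ?thesis
    by (simp add: run_auction_def fold_const funpow_mult del: fold.simps funpow.simps)
qed

lemma run_auction_correct:
  assumes "Range (set (pairs A)) \<subseteq> X" and "finite X"
  shows "(\<forall>x\<in>X. won x (run_auction A) \<noteq> Leaf) \<longleftrightarrow> saturates (set (pairs A)) X"
proof
  let ?A = "set (pairs A)" and ?W = "pairs (run_auction A)"
  have auc: "auction ?A ?W" and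
    stop: "(\<nexists>b. biddable ?A ?W b) \<or> length ?W = Suc (length (elems A)) * Suc (length (elems A))"
    using iterated_bids[of A "Suc (length (elems A)) * Suc (length (elems A))"]
    unfolding run_auction_eq by blast+
  show "saturates ?A X" if "\<forall>x\<in>X. won x (run_auction A) \<noteq> Leaf"
    using that auction_subset[OF auc] by (intro all_won_imp_saturates) (auto simp: won_eq_Leaf)
  assume "saturates ?A X"
  then have hall: "hall ?A X" by (rule saturates_imp_hall) simp
  have "card (Domain ?A) \<le> length (elems A)"
    using card_image_le[of ?A fst] card_length[of "pairs A"] by (simp add: Domain_fst)
  then have "card (Domain ?A) * card (Domain ?A) \<le> length (elems A) * length (elems A)"
    by (intro mult_mono) auto
  also have "\<dots> < Suc (length (elems A)) * Suc (length (elems A))" by simp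
  finally have "length ?W \<noteq> Suc (length (elems A)) * Suc (length (elems A))"
    using auction_length[OF auc _ assms hall] by auto
  with stop have "\<nexists>b. biddable ?A ?W b" by blast
  from stuck_auction_saturates[OF auc _ hall this]
  show "\<forall>x\<in>X. won x (run_auction A) \<noteq> Leaf" by (simp add: won_eq_Leaf)
qed

lemma polytime_winners: "polytime a \<Longrightarrow> polytime (\<lambda>d. winners (a d))"
proof (rule polytime_comp[of winners])
  show "polytime winners"
    unfolding winners_def
    by (rule polytime_fold[where g = "[:1, 1:]"]) (intro polytime_intros | simp)+
qed

lemma polytime_won: "polytime a \<Longrightarrow> polytime b \<Longrightarrow> polytime (\<lambda>d. won (a d) (b d))"
  by (rule polytime_comp2[of won]) (unfold won_def, intro polytime_intros polytime_winners)

lemma polytime_unary_price: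
  "polytime a \<Longrightarrow> polytime b \<Longrightarrow> polytime (\<lambda>d. unary_price (a d) (b d))"
  by (rule polytime_comp2[of unary_price]) (unfold unary_price_def, intro polytime_intros)

lemma polytime_cheaper:
  "polytime a \<Longrightarrow> polytime b \<Longrightarrow> polytime c \<Longrightarrow> polytime (\<lambda>d. cheaper (a d) (b d) (c d))"
  by (rule polytime_comp3[of cheaper]) (unfold cheaper_def, intro polytime_intros polytime_unary_price)

lemma polytime_candidates:
  "polytime a \<Longrightarrow> polytime b \<Longrightarrow> polytime (\<lambda>d. candidates (a d) (b d))"
  by (rule polytime_comp2[of candidates])
    (unfold candidates_def, intro polytime_intros polytime_won polytime_cheaper)

lemma polytime_bid_step:
  "polytime a \<Longrightarrow> polytime b \<Longrightarrow> polytime (\<lambda>d. bid_step (a d) (b d))"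
  by (rule polytime_comp2[of bid_step])
    (unfold bid_step_def, intro polytime_intros polytime_candidates)

lemma nodes_bid_step: "nodes (bid_step A W) \<le> nodes W + Suc (nodes A)"
  by (rule bid_step_cases[of A W]) (auto dest: nodes_elem)

lemma polytime_bid_round:
  "polytime a \<Longrightarrow> polytime b \<Longrightarrow> polytime (\<lambda>d. bid_round (a d) (b d))"
proof (rule polytime_comp2[of bid_round])
  show "polytime (\<lambda>e. bid_round (left e) (right e))"
    unfolding bid_round_def
  proof (rule polytime_fold[where g = "[:1, 1:]"])
    show "nodes (bid_step (left d) acc) \<le> nodes acc + poly [:1, 1:] (nodes d + nodes x)" for d x acc
      using nodes_bid_step[of "left d" acc] nodes_left[of d] by simp
  qed (intro polytime_intros polytime_bid_step)+
qed

lemma polytime_run_auction: "polytime a \<Longrightarrow> polytime (\<lambda>d. run_auction (a d))"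
proof (rule polytime_comp[of run_auction])
  show "polytime run_auction"
    unfolding run_auction_def
  proof (rule polytime_fold[where g = "[:1, 1:] * [:1, 1:]"])
    fix d x acc
    have "nodes (fold (\<lambda>_. bid_step d) xs acc) \<le> nodes acc + length xs * Suc (nodes d)" for xs :: "data list"
    proof (induction xs arbitrary: acc)
      case (Cons x xs)
      show ?case using Cons[of "bid_step d acc"] nodes_bid_step[of d acc] by simp
    qed simp
    from this[of "elems (Node Leaf d)"]
    have "nodes (bid_round d acc) \<le> nodes acc + Suc (length (elems d)) * Suc (nodes d)"
      by (simp add: bid_round_def)
    also have "\<dots> \<le> nodes acc + Suc (nodes d + nodes x) * Suc (nodes d + nodes x)"
      using length_elems[of d] by (intro add_mono mult_mono) auto
    finally show "nodes (bid_round d acc) \<le> nodes acc + poly ([:1, 1:] * [:1, 1:]) (nodes d + nodes x)"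
      by (simp only: poly_mult) simp
  qed (intro polytime_intros polytime_bid_round)+
qed


section \<open>Binary and unary numbers\<close>

lemma enc_nat_0: "enc_nat 0 = Leaf"
  and enc_nat_pos: "n \<noteq> 0 \<Longrightarrow> enc_nat n = Node (enc_bool (odd n)) (enc_nat (n div 2))"
  by (simp_all add: enc_nat.simps)

lemma enc_nat_inj: "enc_nat m = enc_nat n \<Longrightarrow> m = n"
proof (induction m arbitrary: n rule: less_induct)
  case (less m)
  show ?case
  proof (cases "m = 0 \<or> n = 0")
    case True
    with less.prems show ?thesis by (cases "m = 0"; cases "n = 0") (auto simp: enc_nat_0 enc_nat_pos)
  next
    case False
    with less.prems have "odd m = odd n" "enc_nat (m div 2) = enc_nat (n div 2)"
      by (auto simp: enc_nat_pos enc_bool_def split: if_splits)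
    moreover from this False less.IH have "m div 2 = n div 2" by simp
    ultimately show ?thesis by presburger
  qed
qed

lemma enc_nat_eq_iff [simp]: "enc_nat m = enc_nat n \<longleftrightarrow> m = n"
  using enc_nat_inj by blast

text \<open>The binary digits are \<open>Leaf\<close> for zero and \<open>single Leaf\<close> for one.\<close>

fun inc_list :: "data list \<Rightarrow> data list" where
  "inc_list [] = [single Leaf]"
| "inc_list (x # xs) = (if x = Leaf then single Leaf # xs else Leaf # inc_list xs)"

text \<open>The increment yields encodings without leading zeros, so that numbers can be compared by equality
  of trees.\<close>

lemma inc_list_enc_nat: "inc_list (elems (enc_nat n)) = elems (enc_nat (Suc n))"
proof (induction n rule: less_induct)
  case (less n)
  show ?case
  proof (cases "n = 0")
    case True
    then show ?thesis by (simp add: enc_nat_0 enc_nat_pos enc_bool_def)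
  next
    case False
    with less.IH[of "n div 2"] show ?thesis
      by (cases "odd n") (auto simp: enc_nat_pos enc_bool_def)
  qed
qed

definition add_carry :: "data \<Rightarrow> data \<Rightarrow> data" where
  "add_carry x acc =
     (if left acc = Leaf then Node Leaf (Node x (right acc))
      else if x = Leaf then Node Leaf (Node (single Leaf) (right acc))
      else Node (single Leaf) (Node Leaf (right acc)))"

text \<open>The accumulator consists of the carry and of the finished digits, the last one first.\<close>

definition inc :: "data \<Rightarrow> data" where
  "inc d = append_rev (right (fold add_carry (elems d) (Node (single Leaf) Leaf)))
     (if left (fold add_carry (elems d) (Node (single Leaf) Leaf)) = Leaf then Leaf
      else single (single Leaf))"

lemma elems_inc: "elems (inc d) = inc_list (elems d)"
proof -
  define out where "out r = rev (elems (right r)) @ (if left r = Leaf then [] else [single Leaf])" for r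
  have "out (fold add_carry xs acc) =
      rev (elems (right acc)) @ (if left acc = Leaf then xs else inc_list xs)" for xs acc
  proof (induction xs arbitrary: acc)
    case (Cons x xs)
    then show ?case by (simp add: add_carry_def)
  qed (simp add: out_def)
  from this[of "elems d" "Node (single Leaf) Leaf"] show ?thesis
    by (auto simp: inc_def elems_append_rev out_def split: if_splits)
qed

lemma inc_enc_nat: "inc (enc_nat n) = enc_nat (Suc n)"
  using elems_inj elems_inc inc_list_enc_nat by metis

lemma nodes_inc: "nodes (inc d) \<le> nodes d + 4"
proof -
  have "(\<Sum>x\<leftarrow>inc_list xs. Suc (nodes x)) \<le> (\<Sum>x\<leftarrow>xs. Suc (nodes x)) + 4" for xs
  proof (induction xs)
    case (Cons x xs)
    then show ?case by (cases x) auto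
  qed simp
  from this[of "elems d"] show ?thesis
    using nodes_elems[of "inc d"] nodes_elems[of d] unfolding elems_inc by linarith
qed

lemma polytime_inc: "polytime a \<Longrightarrow> polytime (\<lambda>d. inc (a d))"
proof (rule polytime_comp[of inc])
  have carry: "polytime (\<lambda>d. fold add_carry (elems d) (Node (single Leaf) Leaf))"
  proof (rule polytime_fold[where g = "[:10, 1:]"])
    show "polytime (\<lambda>e. add_carry (left (right e)) (right (right e)))"
      unfolding add_carry_def by (intro polytime_intros)
    show "nodes (add_carry x acc) \<le> nodes acc + poly [:10, 1:] (nodes d + nodes x)" for d x acc :: data
      using nodes_right[of acc] by (simp add: add_carry_def)
  qed (intro polytime_intros)+
  show "polytime inc"
    unfolding inc_def by (intro polytime_intros carry)
qed

text \<open>Comparing a binary counter with \<open>q\<close> finds the first \<open>q\<close> entries of the list \<open>l\<close>, a unary number. A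
  direct conversion of \<open>q\<close> could take exponential time; here the list caps the result, and the final
  counter differs from \<open>q\<close> exactly if the list is too short.\<close>

definition count_off :: "data \<Rightarrow> data \<Rightarrow> data" where
  "count_off q l = fold (\<lambda>x acc. if left acc = q then acc
     else Node (inc (left acc)) (Node x (right acc))) (elems l) (Node Leaf Leaf)"

lemma count_off_enc_nat:
  "left (count_off (enc_nat k) l) = enc_nat (min k (length (elems l))) \<and>
   length (elems (right (count_off (enc_nat k) l))) = min k (length (elems l))"
proof -
  let ?F = "\<lambda>x acc. if left acc = enc_nat k then acc else Node (inc (left acc)) (Node x (right acc))"
  have "left (fold ?F xs acc) = enc_nat (min k (j + length xs)) \<and>
      length (elems (right (fold ?F xs acc))) = min k (j + length xs)"
    if "j \<le> k" "left acc = enc_nat j" "length (elems (right acc)) = j" for xs acc j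
    using that
  proof (induction xs arbitrary: acc j)
    case (Cons x xs)
    show ?case
    proof (cases "j = k")
      case True
      with Cons.prems Cons.IH[of k acc] show ?thesis by simp
    next
      case False
      with Cons.prems Cons.IH[of "Suc j" "?F x acc"] show ?thesis by (simp add: inc_enc_nat)
    qed
  qed simp
  from this[of 0 "Node Leaf Leaf" "elems l"] show ?thesis
    by (simp add: count_off_def enc_nat_0)
qed

lemma polytime_count_off:
  "polytime a \<Longrightarrow> polytime b \<Longrightarrow> polytime (\<lambda>d. count_off (a d) (b d))"
proof (rule polytime_comp2[of count_off])
  show "polytime (\<lambda>e. count_off (left e) (right e))"
    unfolding count_off_def
  proof (rule polytime_fold[where g = "[:10, 1:]"])
    show "nodes (if left acc = left d then acc else Node (inc (left acc)) (Node x (right acc)))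
        \<le> nodes acc + poly [:10, 1:] (nodes d + nodes x)" for d x acc
      using nodes_inc[of "left acc"] by (cases acc) auto
  qed (intro polytime_intros polytime_inc)+
qed


section \<open>The decision procedure\<close>

text \<open>A unary form of the number of vertices of the class \<open>t\<close> to be covered: for each tree edge at \<open>t\<close>, as
  many edges of its colour as demanded, provided that there are so many.\<close>

definition tokens :: "data \<Rightarrow> data \<Rightarrow> data" where
  "tokens es t = collect (\<lambda>e.
     if t = left (left e) then right (count_off (right (right e)) (left (right e)))
     else if t = right (left e) then right (count_off (right (right e)) (left (right e)))
     else Leaf) es"

text \<open>Only the number of dummies matters; their names are the entries of \<open>U t\<close> after the first ones, of
  which there are as many as are to be covered.\<close>

definition dummies :: "data \<Rightarrow> data \<Rightarrow> data" where
  "dummies es v = drop_elems (tokens es (left v)) (right v)"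

abbreviation vertex :: "data \<Rightarrow> data" where
  "vertex x \<equiv> Node Leaf x"

abbreviation dummy :: "data \<Rightarrow> data" where
  "dummy z \<equiv> Node (single Leaf) z"

definition both_arcs :: "data \<Rightarrow> data \<Rightarrow> data" where
  "both_arcs a b = Node (Node a b) (single (Node b a))"

definition arc_list :: "data \<Rightarrow> data" where
  "arc_list d = append_rev
     (collect (\<lambda>e. collect (\<lambda>h. both_arcs (vertex (left h)) (vertex (right h))) (left (right e))) (right d))
     (collect (\<lambda>v. collect (\<lambda>x. collect (\<lambda>z. both_arcs (vertex x) (dummy z)) (dummies (right d) v))
       (right v)) (left d))"

definition vertex_list :: "data \<Rightarrow> data" where
  "vertex_list d = collect (\<lambda>v. append_rev (collect (\<lambda>x. single (vertex x)) (right v))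
     (collect (\<lambda>z. single (dummy z)) (dummies (right d) v))) (left d)"

text \<open>The colours and the classes in which the demand exceeds the number of edges or of vertices. There is
  no exact matching if any exist; otherwise no number has been truncated, and the auction decides.\<close>

definition excess_colours :: "data \<Rightarrow> data" where
  "excess_colours d = collect (\<lambda>e.
     if left (count_off (right (right e)) (left (right e))) = right (right e) then Leaf
     else single Leaf) (right d)"

definition excess_degrees :: "data \<Rightarrow> data" where
  "excess_degrees d = collect (\<lambda>v. drop_elems (right v) (tokens (right d) (left v))) (left d)"

definition losers :: "data \<Rightarrow> data" where
  "losers d = collect (\<lambda>x. if won x (run_auction (arc_list d)) = Leaf then single Leaf else Leaf)
     (vertex_list d)"

definition decide :: "data \<Rightarrow> data" where
  "decide d = (if excess_colours d = Leaf
     then (if excess_degrees d = Leaf then (if losers d = Leaf then single Leaf else Leaf) else Leaf)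
     else Leaf)"

lemma polytime_tokens: "polytime a \<Longrightarrow> polytime b \<Longrightarrow> polytime (\<lambda>d. tokens (a d) (b d))"
  by (rule polytime_comp2[of tokens]) (unfold tokens_def, intro polytime_intros polytime_count_off)

lemma polytime_dummies: "polytime a \<Longrightarrow> polytime b \<Longrightarrow> polytime (\<lambda>d. dummies (a d) (b d))"
  by (rule polytime_comp2[of dummies]) (unfold dummies_def, intro polytime_intros polytime_tokens)

lemma polytime_arc_list: "polytime a \<Longrightarrow> polytime (\<lambda>d. arc_list (a d))"
  by (rule polytime_comp[of arc_list])
    (unfold arc_list_def both_arcs_def, intro polytime_intros polytime_dummies)

lemma polytime_decide: "polytime decide"
  unfolding decide_def excess_colours_def excess_degrees_def losers_def vertex_list_def
  by (intro polytime_intros polytime_tokens polytime_dummies polytime_count_off polytime_won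
      polytime_run_auction polytime_arc_list)

lemma elems_enc_list: "elems (enc_list f xs) = map f xs"
  by (induction xs) (simp_all add: enc_list_def)

abbreviation enc_class :: "nat \<times> nat list \<Rightarrow> data" where
  "enc_class \<equiv> enc_pair enc_nat (enc_list enc_nat)"

abbreviation enc_colour :: "(nat \<times> nat) \<times> (nat \<times> nat) list \<times> nat \<Rightarrow> data" where
  "enc_colour \<equiv> enc_pair (enc_pair enc_nat enc_nat)
     (enc_pair (enc_list (enc_pair enc_nat enc_nat)) enc_nat)"

text \<open>The data that stand for the vertices and dummies of the assignment problem.\<close>

primrec name :: "nat + nat \<Rightarrow> data" where
  "name (Inl x) = vertex (enc_nat x)"
| "name (Inr z) = dummy (enc_nat z)"

lemma inj_name: "inj name"
proof (rule injI)
  show "v = w" if "name v = name w" for v w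
    using that by (cases v; cases w) auto
qed

locale encoded_instance = tree_colour_classes V E U H q
  for V :: "nat set" and E U and H :: "nat set \<Rightarrow> nat set set" and q +
  fixes vs :: "(nat \<times> nat list) list" and es :: "((nat \<times> nat) \<times> (nat \<times> nat) list \<times> nat) list"
  assumes describes: "describes (vs, es) V E U H q"
begin

abbreviation d :: data where "d \<equiv> enc_input (vs, es)"

lemma elems_left: "elems (left d) = map enc_class vs"
  and elems_right: "elems (right d) = map enc_colour es"
  by (simp_all add: enc_input_def enc_pair_def[of _ _ "(vs, es)"] elems_enc_list)

lemma classes:
  "distinct (map fst vs)" "set (map fst vs) = V"
  "(t, xs) \<in> set vs \<Longrightarrow> distinct xs \<and> set xs = U t"
  using describes unfolding describes_def by auto

lemma colour_entry:
  "(p, hs, k) \<in> set es \<Longrightarrow> lists_edges hs (H (unordered p)) \<and> k = q (unordered p)"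
  using describes by (auto simp: describes_def)

lemma colours:
  "distinct (map (\<lambda>e. unordered (fst e)) es)" "set (map (\<lambda>e. unordered (fst e)) es) = E"
  "(p, hs, k) \<in> set es \<Longrightarrow> distinct (map unordered hs)"
  "(p, hs, k) \<in> set es \<Longrightarrow> set (map unordered hs) = H (unordered p)"
  "(p, hs, k) \<in> set es \<Longrightarrow> k = q (unordered p)"
proof -
  show "distinct (map (\<lambda>e. unordered (fst e)) es)" "set (map (\<lambda>e. unordered (fst e)) es) = E"
    using describes by (simp_all add: describes_def lists_edges_def o_def)
qed (use colour_entry[unfolded lists_edges_def] in blast)+

lemma length_colour: "(p, hs, k) \<in> set es \<Longrightarrow> length hs = card (H (unordered p))"
  using colours(3,4) by (metis distinct_card length_map)

lemma class_length: "(t, xs) \<in> set vs \<Longrightarrow> length xs = card (U t)"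
  using classes(3) distinct_card by metis

lemma excess_colours_iff: "excess_colours d = Leaf \<longleftrightarrow> (\<forall>e\<in>E. q e \<le> card (H e))"
proof -
  have "excess_colours d = Leaf \<longleftrightarrow> (\<forall>(p, hs, k)\<in>set es. k \<le> length hs)"
    unfolding excess_colours_def collect_eq_Leaf elems_right
    by (auto simp: enc_pair_def count_off_enc_nat elems_enc_list)
  also have "\<dots> \<longleftrightarrow> (\<forall>(p, hs, k)\<in>set es. q (unordered p) \<le> card (H (unordered p)))"
    using colours(5) length_colour by fastforce
  also have "\<dots> \<longleftrightarrow> (\<forall>e\<in>E. q e \<le> card (H e))"
    unfolding colours(2)[symmetric] by fastforce
  finally show ?thesis .
qed

lemma length_tokens:
  assumes "\<forall>e\<in>E. q e \<le> card (H e)"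
  shows "length (elems (tokens (right d) (enc_nat t))) = colour_degree E q t"
proof -
  have "length (elems (tokens (right d) (enc_nat t))) =
      (\<Sum>e\<leftarrow>es. if t \<in> unordered (fst e) then q (unordered (fst e)) else 0)"
    unfolding tokens_def length_collect elems_right map_map
  proof (intro arg_cong[of _ _ sum_list] map_cong[OF refl])
    fix e assume e: "e \<in> set es"
    obtain a b hs k where e_eq: "e = ((a, b), hs, k)" by (metis prod.collapse)
    have "unordered (a, b) \<in> E" using e unfolding e_eq colours(2)[symmetric] by force
    then have "k \<le> length hs" "k = q (unordered (a, b))"
      using assms e colours(5) length_colour unfolding e_eq by auto
    then show "((\<lambda>e. length (elems (if enc_nat t = left (left e)
        then right (count_off (right (right e)) (left (right e)))
        else if enc_nat t = right (left e) then right (count_off (right (right e)) (left (right e)))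
        else Leaf))) \<circ> enc_colour) e = (if t \<in> unordered (fst e) then q (unordered (fst e)) else 0)"
      by (auto simp: e_eq enc_pair_def min_absorb1 count_off_enc_nat elems_enc_list unordered_def)
  qed
  also have "\<dots> = (\<Sum>e\<leftarrow>map (\<lambda>e. unordered (fst e)) es. if t \<in> e then q e else 0)"
    by (simp add: o_def)
  also have "\<dots> = (\<Sum>e\<in>E. if t \<in> e then q e else 0)"
    using colours(1,2) by (simp only: sum_list_distinct_conv_sum_set)
  also have "\<dots> = colour_degree E q t"
    unfolding colour_degree_def using finite_E by (rule sum.inter_filter[symmetric])
  finally show ?thesis .
qed

lemma excess_degrees_iff:
  assumes "\<forall>e\<in>E. q e \<le> card (H e)"
  shows "excess_degrees d = Leaf \<longleftrightarrow> (\<forall>t\<in>V. colour_degree E q t \<le> card (U t))"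
proof -
  have "excess_degrees d = Leaf \<longleftrightarrow> (\<forall>(t, xs)\<in>set vs. colour_degree E q t \<le> length xs)"
    unfolding excess_degrees_def collect_eq_Leaf elems_left
    by (auto simp: enc_pair_def drop_elems_eq_Leaf length_tokens[OF assms] elems_enc_list)
  also have "\<dots> \<longleftrightarrow> (\<forall>(t, xs)\<in>set vs. colour_degree E q t \<le> card (U t))"
    using class_length by fastforce
  also have "\<dots> \<longleftrightarrow> (\<forall>t\<in>V. colour_degree E q t \<le> card (U t))"
    unfolding classes(2)[symmetric] by fastforce
  finally show ?thesis .
qed

definition W :: "nat \<Rightarrow> nat set" where
  "W t = set (drop (colour_degree E q t) (the (map_of vs t)))"

lemma W_eq: "(t, xs) \<in> set vs \<Longrightarrow> W t = set (drop (colour_degree E q t) xs)"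
  using classes(1) by (simp add: W_def)

lemma with_dummies:
  assumes "\<forall>t\<in>V. colour_degree E q t \<le> card (U t)"
  shows "tree_colour_classes_with_dummies V E U H q W"
proof unfold_locales
  fix t assume "t \<in> V"
  then obtain xs where xs: "(t, xs) \<in> set vs" unfolding classes(2)[symmetric] by auto
  show "W t \<subseteq> U t" using W_eq[OF xs] classes(3)[OF xs] set_drop_subset by fast
  have "card (W t) = length (drop (colour_degree E q t) xs)"
    using classes(3)[OF xs] W_eq[OF xs] by (simp add: distinct_card)
  then show "card (W t) + colour_degree E q t = card (U t)"
    using class_length[OF xs] assms \<open>t \<in> V\<close> by simp
qed

lemma elems_dummies:
  assumes "\<forall>e\<in>E. q e \<le> card (H e)" and "(t, xs) \<in> set vs"
  shows "set (elems (dummies (right d) (enc_class (t, xs)))) = enc_nat ` W t"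
  using W_eq[OF assms(2)]
  by (simp add: dummies_def elems_drop_elems enc_pair_def length_tokens[OF assms(1)] elems_enc_list
      drop_map)

lemma ball_classes: "(\<Union>v\<in>set vs. f (fst v) (set (snd v))) = (\<Union>t\<in>V. f t (U t))"
proof -
  have "(\<Union>v\<in>set vs. f (fst v) (set (snd v))) = (\<Union>v\<in>set vs. f (fst v) (U (fst v)))"
    using classes(3) by (intro SUP_cong) auto
  then show ?thesis unfolding classes(2)[symmetric] by simp
qed

lemma set_vertex_list:
  assumes "\<forall>e\<in>E. q e \<le> card (H e)"
  shows "set (elems (vertex_list d)) = name ` dummy_vertices V U W"
proof -
  have "set (elems (vertex_list d)) =
      (\<Union>v\<in>set vs. (\<lambda>x. vertex (enc_nat x)) ` set (snd v) \<union> (\<lambda>z. dummy (enc_nat z)) ` W (fst v))"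
    unfolding vertex_list_def set_collect elems_left set_map image_image
  proof (rule SUP_cong[OF refl])
    fix v assume v: "v \<in> set vs"
    have dm: "set (elems (dummies (right d) (enc_class v))) = enc_nat ` W (fst v)"
      using elems_dummies[OF assms, of "fst v" "snd v"] v by simp
    have "right (enc_class v) = enc_list enc_nat (snd v)" by (simp add: enc_pair_def)
    with dm show "set (elems (append_rev (collect (\<lambda>x. single (vertex x)) (right (enc_class v)))
        (collect (\<lambda>z. single (dummy z)) (dummies (right d) (enc_class v))))) =
        (\<lambda>x. vertex (enc_nat x)) ` set (snd v) \<union> (\<lambda>z. dummy (enc_nat z)) ` W (fst v)"
      by (auto simp: elems_append_rev set_collect elems_enc_list)
  qed
  also have "\<dots> = (\<Union>t\<in>V. (\<lambda>x. vertex (enc_nat x)) ` U t \<union> (\<lambda>z. dummy (enc_nat z)) ` W t)"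
    by (rule ball_classes[of "\<lambda>t xs. (\<lambda>x. vertex (enc_nat x)) ` xs \<union> (\<lambda>z. dummy (enc_nat z)) ` W t"])
  also have "\<dots> = name ` dummy_vertices V U W"
    unfolding dummy_vertices_def image_Un image_UN image_image UN_Un_distrib by simp
  finally show ?thesis .
qed

lemma set_pairs_arc_list:
  assumes "\<forall>e\<in>E. q e \<le> card (H e)"
  shows "set (pairs (arc_list d)) = map_prod name name ` dummy_arcs V E U H W"
proof -
  let ?both = "\<lambda>a b. {(a, b), (b, a)} :: (data \<times> data) set"
  have both: "as_pair ` set (elems (both_arcs a b)) = ?both a b" for a b
    by (simp add: both_arcs_def)
  let ?e = "\<lambda>h. ?both (vertex (enc_nat (fst h))) (vertex (enc_nat (snd h)))"
  let ?d = "\<lambda>x z. ?both (vertex (enc_nat x)) (dummy (enc_nat z))"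
  have "set (pairs (arc_list d)) =
      (\<Union>e\<in>set es. \<Union>h\<in>set (fst (snd e)). ?e h) \<union> (\<Union>v\<in>set vs. \<Union>x\<in>set (snd v). \<Union>z\<in>W (fst v). ?d x z)"
  proof -
    have "as_pair ` set (elems (collect (\<lambda>h. both_arcs (vertex (left h)) (vertex (right h)))
        (left (right (enc_colour e))))) = (\<Union>h\<in>set (fst (snd e)). ?e h)" for e
      unfolding set_collect image_UN both by (simp add: enc_pair_def elems_enc_list)
    moreover have "as_pair ` set (elems (collect (\<lambda>x. collect (\<lambda>z. both_arcs (vertex x) (dummy z))
        (dummies (right d) (enc_class v))) (right (enc_class v)))) =
        (\<Union>x\<in>set (snd v). \<Union>z\<in>W (fst v). ?d x z)" if v: "v \<in> set vs" for v
    proof -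
      have dm: "set (elems (dummies (right d) (enc_class v))) = enc_nat ` W (fst v)"
        using elems_dummies[OF assms, of "fst v" "snd v"] v by simp
      show ?thesis
        unfolding set_collect image_UN both dm by (simp add: enc_pair_def elems_enc_list)
    qed
    ultimately show ?thesis
      unfolding arc_list_def set_map elems_append_rev set_append set_rev image_Un
        set_collect[of _ "left d"] set_collect[of _ "right d"] elems_left elems_right image_UN
      by (simp add: image_image)
  qed
  also have "(\<Union>v\<in>set vs. \<Union>x\<in>set (snd v). \<Union>z\<in>W (fst v). ?d x z) = (\<Union>t\<in>V. \<Union>x\<in>U t. \<Union>z\<in>W t. ?d x z)"
    by (rule ball_classes[of "\<lambda>t xs. \<Union>x\<in>xs. \<Union>z\<in>W t. ?d x z"])
  also have "\<dots> = map_prod name name ` ({(Inl x, Inr z) | x z. \<exists>t\<in>V. x \<in> U t \<and> z \<in> W t} \<union>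
      {(Inr z, Inl x) | x z. \<exists>t\<in>V. x \<in> U t \<and> z \<in> W t})"
    (is "?L = ?R")
  proof
    show "?L \<subseteq> ?R"
    proof
      fix a assume "a \<in> ?L"
      then obtain t x z where "t \<in> V" "x \<in> U t" "z \<in> W t"
        "a = map_prod name name (Inl x, Inr z) \<or> a = map_prod name name (Inr z, Inl x)" by auto
      then show "a \<in> ?R" by blast
    qed
    show "?R \<subseteq> ?L" by fastforce
  qed
  also have "(\<Union>e\<in>set es. \<Union>h\<in>set (fst (snd e)). ?e h) =
      map_prod name name ` {(Inl x, Inl y) | x y. \<exists>e\<in>E. {x, y} \<in> H e}"
    (is "?L = ?R")
  proof
    show "?L \<subseteq> ?R"
    proof
      fix a assume "a \<in> ?L"
      then obtain p hs k x y where *: "(p, hs, k) \<in> set es" "(x, y) \<in> set hs"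
        "a = map_prod name name (Inl x, Inl y) \<or> a = map_prod name name (Inl y, Inl x)" by force
      have "unordered p \<in> E" using *(1) unfolding colours(2)[symmetric] by force
      moreover have "unordered (x, y) \<in> H (unordered p)"
        using *(2) unfolding colours(4)[OF *(1), symmetric] by force
      then have "{x, y} \<in> H (unordered p)" "{y, x} \<in> H (unordered p)"
        by (simp_all add: unordered_def insert_commute)
      ultimately show "a \<in> ?R" using *(3) by blast
    qed
    show "?R \<subseteq> ?L"
    proof
      fix a assume "a \<in> ?R"
      then obtain x y e where a: "a = map_prod name name (Inl x, Inl y)" "e \<in> E" "{x, y} \<in> H e" by auto
      from a(2) obtain c where "c \<in> set es" "e = unordered (fst c)"
        unfolding colours(2)[symmetric] set_map by (rule imageE)
      then obtain p hs k where p: "(p, hs, k) \<in> set es" "e = unordered p" by (metis prod.collapse)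
      from a(3) obtain h where h: "h \<in> set hs" "{x, y} = unordered h"
        unfolding p(2) colours(4)[OF p(1), symmetric] set_map by (rule imageE)
      then have "h = (x, y) \<or> h = (y, x)"
        by (cases h) (auto simp: unordered_def doubleton_eq_iff)
      then have "a \<in> ?e h" using a(1) by auto
      with p(1) h(1) show "a \<in> ?L" by force
    qed
  qed
  finally show ?thesis unfolding dummy_arcs_def image_Un by (simp add: Un_assoc)
qed

theorem decide_correct: "decide d \<noteq> Leaf \<longleftrightarrow> (\<exists>M. exact_matching E H q M)"
proof (cases "(\<forall>e\<in>E. q e \<le> card (H e)) \<and> (\<forall>t\<in>V. colour_degree E q t \<le> card (U t))")
  case False
  then have "\<not> (\<exists>M. exact_matching E H q M)" using exact_matching_bounds by blast
  moreover have "decide d = Leaf"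
    using False excess_colours_iff excess_degrees_iff by (auto simp: decide_def)
  ultimately show ?thesis by simp
next
  case True
  then interpret tree_colour_classes_with_dummies V E U H q W using with_dummies by blast
  let ?X = "name ` dummy_vertices V U W"
  have pairs: "set (pairs (arc_list d)) = map_prod name name ` A"
    using set_pairs_arc_list True by blast
  have "Range A \<subseteq> dummy_vertices V U W"
  proof
    fix v assume "v \<in> Range A"
    then consider x y e where "v = Inl y" "e \<in> E" "{x, y} \<in> H e"
      | x z t where "v = Inl x \<or> v = Inr z" "t \<in> V" "x \<in> U t" "z \<in> W t"
      unfolding dummy_arcs_def by blast
    then show "v \<in> dummy_vertices V U W"
    proof cases
      case 1
      from H_edge[OF 1(2,3)] obtain t u a b
        where "t \<in> V" "u \<in> V" "a \<in> U t" "b \<in> U u" "{x, y} = {a, b}" by metis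
      with 1(1) show ?thesis by (auto simp: dummy_vertices_def doubleton_eq_iff)
    next
      case 2
      then show ?thesis by (auto simp: dummy_vertices_def)
    qed
  qed
  then have range: "Range (set (pairs (arc_list d))) \<subseteq> ?X"
    unfolding pairs by force
  have "decide d \<noteq> Leaf \<longleftrightarrow> losers d = Leaf"
    using True excess_colours_iff excess_degrees_iff by (simp add: decide_def)
  also have "\<dots> \<longleftrightarrow> (\<forall>x\<in>?X. won x (run_auction (arc_list d)) \<noteq> Leaf)"
    using set_vertex_list True unfolding losers_def collect_eq_Leaf by auto
  also have "\<dots> \<longleftrightarrow> saturates (set (pairs (arc_list d))) ?X"
    using range finite_V finite_U finite_W
    by (intro run_auction_correct) (auto simp: dummy_vertices_def)
  also have "\<dots> \<longleftrightarrow> saturates A (dummy_vertices V U W)"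
    unfolding pairs by (rule saturates_image[OF inj_name])
  also have "\<dots> \<longleftrightarrow> (\<exists>M. exact_matching E H q M)"
    by (rule exact_matching_iff_saturates[symmetric])
  finally show ?thesis .
qed

end

lemma decidable_in_poly_time_if_polytime:
  assumes "polytime f" and "\<And>d a. (d, a) \<in> P \<Longrightarrow> f d \<noteq> Leaf \<longleftrightarrow> a"
  shows "decidable_in_poly_time P"
proof -
  from assms(1) obtain p c where "runs c 0 f (poly p)" unfolding polytime_def by blast
  then have *: "\<exists>n s'. exec c s n s' \<and> s' 0 = f (s 0) \<and> n \<le> poly p (nodes (s 0))" for s
    unfolding runs_def by blast
  show ?thesis
    unfolding decidable_in_poly_time_def
  proof (intro exI[of _ c] exI[of _ p] ballI, clarify)
    fix d a assume "(d, a) \<in> P"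
    from *[of "(\<lambda>_. Leaf)(0 := d)"] obtain n s
      where "exec c ((\<lambda>_. Leaf)(0 := d)) n s" "s 0 = f d" "n \<le> poly p (nodes d)" by auto
    with assms(2)[OF \<open>(d, a) \<in> P\<close>]
    show "\<exists>n s. exec c ((\<lambda>_. Leaf)(0 := d)) n s \<and> n \<le> poly p (nodes d) \<and> (s 0 \<noteq> Leaf) = a"
      by (intro exI[of _ n] exI[of _ s]) simp
  qed
qed

theorem corollary4p4:
  shows "(\<forall>(V :: 't set) E (U :: 't \<Rightarrow> 'v set) H q. tree_colour_classes V E U H q \<longrightarrow>
           ((\<exists>M. exact_matching E H q M) \<longleftrightarrow>
            (\<forall>F\<subseteq>E. \<nu> (\<Union>e\<in>F. H e) \<ge> (\<Sum>e\<in>F. q e)))) \<and>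
         decidable_in_poly_time
           {(enc_input I, \<exists>M. exact_matching E H q M) | I V E U H q.
              tree_colour_classes V E U H q \<and> describes I V E U H q}"
proof (intro conjI allI impI)
  fix V :: "'t set" and E and U :: "'t \<Rightarrow> 'v set" and H q
  assume "tree_colour_classes V E U H q"
  then show "(\<exists>M. exact_matching E H q M) \<longleftrightarrow> (\<forall>F\<subseteq>E. \<nu> (\<Union>e\<in>F. H e) \<ge> (\<Sum>e\<in>F. q e))"
    by (rule tree_colour_classes.exact_matching_iff_matching_numbers)
next
  show "decidable_in_poly_time {(enc_input I, \<exists>M. exact_matching E H q M) | I V E U H q.
      tree_colour_classes V E U H q \<and> describes I V E U H q}"
  proof (rule decidable_in_poly_time_if_polytime[OF polytime_decide])
    fix d a
    assume "(d, a) \<in> {(enc_input I, \<exists>M. exact_matching E H q M) | I V E U H q.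
      tree_colour_classes V E U H q \<and> describes I V E U H q}"
    then obtain vs es V E U H q where *: "d = enc_input (vs, es)" "a = (\<exists>M. exact_matching E H q M)"
      "tree_colour_classes V E U H q" "describes (vs, es) V E U H q" by auto
    then interpret encoded_instance V E U H q vs es
      by (simp add: encoded_instance_def encoded_instance_axioms_def)
    show "decide d \<noteq> Leaf \<longleftrightarrow> a" using decide_correct *(1,2) by simp
  qed
qed

end
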